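(* Let $J\colon L^2(0,1)\to L^2(0,1)$, $[Jx](s)=\int_0^s x(t)\,dt$ $(0\le s\le 1)$, be the integration operator and let $B^{(H)}\colon L^2(0,1)\to \ell^2$, $[B^{(H)}z]_j=\int_0^1 t^{j-1}z(t)\,dt$ $(j=1,2,\dots)$, be the Hausdorff moment operator. Then there exists a constant $C>0$ such that $$\sigma_i\left(B^{(H)}\circ J\right)\le \frac{C}{i^{3/2}}\qquad (i\in\mathbb{N}).$$ Consequently, there is some constant $K>0$ such that $$\frac{\sigma_i(B^{(H)}\circ J)}{\sigma_i(J)}\le \frac{K}{i^{1/2}}\qquad (i\in\mathbb{N}).$$
   Context: All function spaces are real. For a compact linear operator $T$ between Hilbert spaces, $\sigma_1(T)\ge\sigma_2(T)\ge\dots$ denote its singular values, listed in non-increasing order with multiplicity; $\mathbb{N}=\{1,2,\dots\}$. The operator $J$ is compact and $B^{(H)}$ is bounded, so $B^{(H)}\circ J\colon L^2(0,1)\to\ell^2$ is compact. *)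

theory Defs
  imports "HOL-Analysis.Analysis"
begin

section \<open>The real sequence space \<open>\<ell>\<^sup>2\<close>\<close>

text \<open>Sequences are indexed from \<open>0\<close>: the coordinate called \<open>j\<close> (\<open>j = 1, 2, \<dots>\<close>) in the
  usual notation is the coordinate \<open>j - 1\<close> here.\<close>

typedef ell2 = "{x :: nat \<Rightarrow> real. summable (\<lambda>j. (x j)\<^sup>2)}"
  morphisms ell2_nth Abs_ell2
  by (rule exI[of _ "\<lambda>_. 0"]) simp

setup_lifting type_definition_ell2

lemma summable_mult_of_squares:
  fixes x y :: "nat \<Rightarrow> real"
  assumes "summable (\<lambda>j. (x j)\<^sup>2)" "summable (\<lambda>j. (y j)\<^sup>2)"
  shows "summable (\<lambda>j. x j * y j)"
proof (rule summable_comparison_test'[where N = 0])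
  show "summable (\<lambda>j. (x j)\<^sup>2 + (y j)\<^sup>2)"
    using assms by (rule summable_add)
  show "norm (x j * y j) \<le> (x j)\<^sup>2 + (y j)\<^sup>2" for j
    using sum_squares_bound[of "\<bar>x j\<bar>" "\<bar>y j\<bar>"]
    mult_nonneg_nonneg[OF abs_ge_zero abs_ge_zero, of "x j" "y j"]
    unfolding real_norm_def abs_mult power2_abs by linarith
qed

lemma summable_add_square:
  fixes x y :: "nat \<Rightarrow> real"
  assumes "summable (\<lambda>j. (x j)\<^sup>2)" "summable (\<lambda>j. (y j)\<^sup>2)"
  shows "summable (\<lambda>j. (x j + y j)\<^sup>2)"
proof -
  have "(\<lambda>j. (x j + y j)\<^sup>2) = (\<lambda>j. (x j)\<^sup>2 + (y j)\<^sup>2 + 2 * (x j * y j))"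
    by (simp add: fun_eq_iff power2_sum mult.assoc)
  then show ?thesis
    using summable_add[OF summable_add[OF assms] summable_mult[OF summable_mult_of_squares[OF assms], of 2]]
    by simp
qed

instantiation ell2 :: real_inner
begin

lift_definition zero_ell2 :: ell2 is "\<lambda>_. 0" by simp
lift_definition plus_ell2 :: "ell2 \<Rightarrow> ell2 \<Rightarrow> ell2" is "\<lambda>x y j. x j + y j"
  by (rule summable_add_square)
lift_definition uminus_ell2 :: "ell2 \<Rightarrow> ell2" is "\<lambda>x j. - x j" by simp
lift_definition minus_ell2 :: "ell2 \<Rightarrow> ell2 \<Rightarrow> ell2" is "\<lambda>x y j. x j - y j"
proof -
  fix x y :: "nat \<Rightarrow> real"
  assume "summable (\<lambda>j. (x j)\<^sup>2)" "summable (\<lambda>j. (y j)\<^sup>2)"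
  then show "summable (\<lambda>j. (x j - y j)\<^sup>2)"
    using summable_add_square[of x "\<lambda>j. - y j"] by simp
qed
lift_definition scaleR_ell2 :: "real \<Rightarrow> ell2 \<Rightarrow> ell2" is "\<lambda>c x j. c * x j"
  unfolding power_mult_distrib by (rule summable_mult)
lift_definition inner_ell2 :: "ell2 \<Rightarrow> ell2 \<Rightarrow> real" is "\<lambda>x y. \<Sum>j. x j * y j" .

definition norm_ell2 :: "ell2 \<Rightarrow> real" where "norm_ell2 x = sqrt (inner x x)"
definition dist_ell2 :: "ell2 \<Rightarrow> ell2 \<Rightarrow> real" where "dist_ell2 x y = norm (x - y)"
definition sgn_ell2 :: "ell2 \<Rightarrow> ell2" where "sgn_ell2 x = inverse (norm x) *\<^sub>R x"
definition uniformity_ell2 :: "(ell2 \<times> ell2) filter"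
  where "uniformity_ell2 = (INF e\<in>{0<..}. principal {(x, y). dist x y < e})"
definition open_ell2 :: "ell2 set \<Rightarrow> bool"
  where "open_ell2 U \<longleftrightarrow> (\<forall>x\<in>U. \<forall>\<^sub>F (x', y) in uniformity. x' = x \<longrightarrow> y \<in> U)"

instance
proof
  fix x y z :: ell2 and a b :: real
  show "x + y + z = x + (y + z)" by transfer (simp add: add.assoc)
  show "x + y = y + x" by transfer (simp add: add.commute)
  show "0 + x = x" by transfer simp
  show "- x + x = 0" by transfer simp
  show "x - y = x + - y" by transfer simp
  show "a *\<^sub>R (x + y) = a *\<^sub>R x + a *\<^sub>R y" by transfer (simp add: algebra_simps)
  show "(a + b) *\<^sub>R x = a *\<^sub>R x + b *\<^sub>R x" by transfer (simp add: algebra_simps)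
  show "a *\<^sub>R b *\<^sub>R x = (a * b) *\<^sub>R x" by transfer (simp add: algebra_simps)
  show "1 *\<^sub>R x = x" by transfer simp
  show "inner x y = inner y x" by transfer (simp only: mult.commute)
  show "inner (x + y) z = inner x z + inner y z"
  proof transfer
    fix x y z :: "nat \<Rightarrow> real"
    assume "summable (\<lambda>j. (x j)\<^sup>2)" "summable (\<lambda>j. (y j)\<^sup>2)" "summable (\<lambda>j. (z j)\<^sup>2)"
    then show "(\<Sum>j. (x j + y j) * z j) = (\<Sum>j. x j * z j) + (\<Sum>j. y j * z j)"
      unfolding distrib_right by (intro suminf_add[symmetric] summable_mult_of_squares)
  qed
  show "inner (a *\<^sub>R x) y = a * inner x y"
  proof transfer
    fix a :: real and x y :: "nat \<Rightarrow> real"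
    assume "summable (\<lambda>j. (x j)\<^sup>2)" "summable (\<lambda>j. (y j)\<^sup>2)"
    then show "(\<Sum>j. a * x j * y j) = a * (\<Sum>j. x j * y j)"
      unfolding mult.assoc by (intro suminf_mult summable_mult_of_squares)
  qed
  show "0 \<le> inner x x"
  proof transfer
    fix x :: "nat \<Rightarrow> real"
    assume "summable (\<lambda>j. (x j)\<^sup>2)"
    then show "0 \<le> (\<Sum>j. x j * x j)"
      unfolding power2_eq_square by (rule suminf_nonneg) simp
  qed
  show "inner x x = 0 \<longleftrightarrow> x = 0"
  proof transfer
    fix x :: "nat \<Rightarrow> real"
    assume "summable (\<lambda>j. (x j)\<^sup>2)"
    then have "(\<Sum>j. x j * x j) = 0 \<longleftrightarrow> (\<forall>j. x j * x j = 0)"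
      unfolding power2_eq_square by (rule suminf_eq_zero_iff) simp
    then show "(\<Sum>j. x j * x j) = 0 \<longleftrightarrow> x = (\<lambda>_. 0)"
      by (simp add: fun_eq_iff)
  qed
qed (rule norm_ell2_def dist_ell2_def sgn_ell2_def uniformity_ell2_def open_ell2_def)+

end

section \<open>The space \<open>L\<^sup>2(0,1)\<close>\<close>

abbreviation unit_measure :: "real measure"
  where "unit_measure \<equiv> restrict_space lborel {0<..<1}"

definition square_integrable :: "(real \<Rightarrow> real) \<Rightarrow> bool"
  where "square_integrable f \<longleftrightarrow>
    f \<in> borel_measurable unit_measure \<and> integrable unit_measure (\<lambda>t. (f t)\<^sup>2)"

lemma finite_measure_unit: "finite_measure unit_measure"
  by (rule finite_measureI) (simp add: space_restrict_space emeasure_restrict_space)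

lemma square_integrable_mult:
  assumes "square_integrable f" "square_integrable g"
  shows "integrable unit_measure (\<lambda>t. f t * g t)"
proof (rule Bochner_Integration.integrable_bound)
  show "integrable unit_measure (\<lambda>t. (f t)\<^sup>2 + (g t)\<^sup>2)"
    using assms by (simp add: square_integrable_def)
  show "(\<lambda>t. f t * g t) \<in> borel_measurable unit_measure"
    using assms unfolding square_integrable_def by (intro borel_measurable_times) auto
  have "norm (f t * g t) \<le> norm ((f t)\<^sup>2 + (g t)\<^sup>2)" for t
    using sum_squares_bound[of "\<bar>f t\<bar>" "\<bar>g t\<bar>"]
    mult_nonneg_nonneg[OF abs_ge_zero abs_ge_zero, of "f t" "g t"]
      abs_ge_self[of "(f t)\<^sup>2 + (g t)\<^sup>2"]
    unfolding real_norm_def abs_mult power2_abs by linarith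
  then show "AE t in unit_measure. norm (f t * g t) \<le> norm ((f t)\<^sup>2 + (g t)\<^sup>2)"
    by simp
qed

lemma square_integrable_bounded:
  assumes "f \<in> borel_measurable unit_measure" "\<And>t. t \<in> {0<..<1} \<Longrightarrow> \<bar>f t\<bar> \<le> B"
  shows "square_integrable f"
proof -
  interpret finite_measure unit_measure by (rule finite_measure_unit)
  have "integrable unit_measure (\<lambda>t. (f t)\<^sup>2)"
  proof (rule integrable_const_bound)
    show "(\<lambda>t. (f t)\<^sup>2) \<in> borel_measurable unit_measure" using assms(1) by simp
    have "norm ((f t)\<^sup>2) \<le> B\<^sup>2" if "t \<in> {0<..<1}" for t
      using power_mono[OF assms(2)[OF that], of 2] by simp
    then show "AE t in unit_measure. norm ((f t)\<^sup>2) \<le> B\<^sup>2"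
      by (intro AE_I2) (simp add: space_restrict_space)
  qed
  then show ?thesis using assms(1) by (simp add: square_integrable_def)
qed

lemma square_integrable_power: "square_integrable (\<lambda>t. t ^ j)"
  by (rule square_integrable_bounded[where B = 1])
     (auto intro!: measurable_restrict_space1 simp: power_le_one)

lemma square_integrable_integrable:
  assumes "square_integrable f"
  shows "integrable unit_measure f"
  using square_integrable_mult[OF assms square_integrable_power[of 0]] by simp

lemma square_integrable_add:
  assumes "square_integrable f" "square_integrable g"
  shows "square_integrable (\<lambda>t. f t + g t)"
  unfolding square_integrable_def
proof
  show "(\<lambda>t. f t + g t) \<in> borel_measurable unit_measure"
    using assms unfolding square_integrable_def by (intro borel_measurable_add) auto
  show "integrable unit_measure (\<lambda>t. (f t + g t)\<^sup>2)"
    using assms square_integrable_mult[OF assms]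
    by (simp add: square_integrable_def power2_sum mult.assoc)
qed

lemma square_integrable_scale:
  assumes "square_integrable f"
  shows "square_integrable (\<lambda>t. c * f t)"
  using assms unfolding square_integrable_def
  by (auto simp: power_mult_distrib intro: borel_measurable_times)

lemma square_integrable_minus:
  assumes "square_integrable f"
  shows "square_integrable (\<lambda>t. - f t)"
  using square_integrable_scale[OF assms, of "-1"] by simp

lemma square_integrable_diff:
  assumes "square_integrable f" "square_integrable g"
  shows "square_integrable (\<lambda>t. f t - g t)"
  using square_integrable_add[OF assms(1) square_integrable_minus[OF assms(2)]] by simp

quotient_type L2_unit = "real \<Rightarrow> real" / partial:
  "\<lambda>f g. square_integrable f \<and> square_integrable g \<and> (AE t in unit_measure. f t = g t)"
proof (rule part_equivpI)
  show "\<exists>f. square_integrable f \<and> square_integrable f \<and> (AE t in unit_measure. f t = f t)"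
    using square_integrable_power[of 0] by auto
  show "symp (\<lambda>f g. square_integrable f \<and> square_integrable g \<and> (AE t in unit_measure. f t = g t))"
    by (auto intro!: sympI elim: eventually_mono)
  show "transp (\<lambda>f g. square_integrable f \<and> square_integrable g \<and> (AE t in unit_measure. f t = g t))"
    by (auto intro!: transpI elim: eventually_elim2)
qed

instantiation L2_unit :: real_inner
begin

lift_definition zero_L2_unit :: L2_unit is "\<lambda>_. 0"
  by (simp add: square_integrable_def)
lift_definition plus_L2_unit :: "L2_unit \<Rightarrow> L2_unit \<Rightarrow> L2_unit" is "\<lambda>f g t. f t + g t"
  by (auto simp: square_integrable_add elim: eventually_elim2)
lift_definition uminus_L2_unit :: "L2_unit \<Rightarrow> L2_unit" is "\<lambda>f t. - f t"
  by (auto simp: square_integrable_minus)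
lift_definition minus_L2_unit :: "L2_unit \<Rightarrow> L2_unit \<Rightarrow> L2_unit" is "\<lambda>f g t. f t - g t"
  by (auto simp: square_integrable_diff elim: eventually_elim2)
lift_definition scaleR_L2_unit :: "real \<Rightarrow> L2_unit \<Rightarrow> L2_unit" is "\<lambda>c f t. c * f t"
  by (auto simp: square_integrable_scale)
lift_definition inner_L2_unit :: "L2_unit \<Rightarrow> L2_unit \<Rightarrow> real"
  is "\<lambda>f g. LINT t|unit_measure. f t * g t"
  by (rule integral_cong_AE) (auto simp: square_integrable_def elim: eventually_elim2)

definition norm_L2_unit :: "L2_unit \<Rightarrow> real" where "norm_L2_unit x = sqrt (inner x x)"
definition dist_L2_unit :: "L2_unit \<Rightarrow> L2_unit \<Rightarrow> real" where "dist_L2_unit x y = norm (x - y)"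
definition sgn_L2_unit :: "L2_unit \<Rightarrow> L2_unit" where "sgn_L2_unit x = inverse (norm x) *\<^sub>R x"
definition uniformity_L2_unit :: "(L2_unit \<times> L2_unit) filter"
  where "uniformity_L2_unit = (INF e\<in>{0<..}. principal {(x, y). dist x y < e})"
definition open_L2_unit :: "L2_unit set \<Rightarrow> bool"
  where "open_L2_unit U \<longleftrightarrow> (\<forall>x\<in>U. \<forall>\<^sub>F (x', y) in uniformity. x' = x \<longrightarrow> y \<in> U)"

instance
proof
  fix x y z :: L2_unit and a b :: real
  show "x + y + z = x + (y + z)"
    by transfer (simp add: square_integrable_add add.assoc)
  show "x + y = y + x" by transfer (simp add: square_integrable_add add.commute)
  show "0 + x = x" by transfer simp
  show "- x + x = 0" by transfer (simp add: square_integrable_def)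
  show "x - y = x + - y"
    by transfer (simp add: square_integrable_diff)
  show "a *\<^sub>R (x + y) = a *\<^sub>R x + a *\<^sub>R y"
    by transfer (simp add: square_integrable_add square_integrable_scale algebra_simps)
  show "(a + b) *\<^sub>R x = a *\<^sub>R x + b *\<^sub>R x"
    by transfer (simp add: square_integrable_add square_integrable_scale distrib_right)
  show "a *\<^sub>R b *\<^sub>R x = (a * b) *\<^sub>R x"
    by transfer (simp add: square_integrable_scale algebra_simps)
  show "1 *\<^sub>R x = x" by transfer simp
  show "inner x y = inner y x" by transfer (simp add: mult.commute)
  show "inner (x + y) z = inner x z + inner y z"
    by transfer (simp add: distrib_right square_integrable_mult)
  show "inner (a *\<^sub>R x) y = a * inner x y"
    by transfer (simp add: mult.assoc)
  show "0 \<le> inner x x" by transfer (simp add: integral_nonneg_AE)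
  show "inner x x = 0 \<longleftrightarrow> x = 0"
  proof transfer
    fix f :: "real \<Rightarrow> real"
    assume "square_integrable f \<and> square_integrable f \<and> (AE t in unit_measure. f t = f t)"
    moreover have "square_integrable (\<lambda>_. 0)" by (simp add: square_integrable_def)
    ultimately show "((LINT t|unit_measure. f t * f t) = 0) =
      (square_integrable f \<and> square_integrable (\<lambda>_. 0) \<and> (AE t in unit_measure. f t = 0))"
      by (subst integral_nonneg_eq_0_iff_AE) (auto simp: square_integrable_mult)
  qed
qed (rule norm_L2_unit_def dist_L2_unit_def sgn_L2_unit_def uniformity_L2_unit_def
    open_L2_unit_def)+

end

section \<open>The integration operator and the Hausdorff moment operator\<close>

lemma square_integrable_lborel:
  assumes "square_integrable f"
  shows "integrable lborel (\<lambda>t. indicator {0<..<1} t * f t)"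
  using square_integrable_integrable[OF assms] by (simp add: integrable_restrict_space)

lemma primitive_cong:
  fixes f :: "real \<Rightarrow> real"
  assumes "s \<in> {0<..<1}"
  shows "(LBINT t:{0<..<s}. f t)
    = (LINT t|lborel. indicator {0<..<s} t * (indicator {0<..<1} t * f t))"
  unfolding set_lebesgue_integral_def
  by (rule Bochner_Integration.integral_cong) (use assms in \<open>auto simp: indicator_def\<close>)

lemma square_integrable_primitive:
  assumes "square_integrable f"
  shows "square_integrable (\<lambda>s. LBINT t:{0<..<s}. f t)"
proof (rule square_integrable_bounded)
  let ?f = "\<lambda>t. indicator {0<..<1} t * f t"
  have [measurable]: "?f \<in> borel_measurable borel"
    using borel_measurable_integrable[OF square_integrable_lborel[OF assms]] by simp
  have "(\<lambda>s. LINT t|lborel. (if 0 < t \<and> t < s then ?f t else 0)) \<in> borel_measurable borel"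
    by measurable
  also have "(\<lambda>s. LINT t|lborel. (if 0 < t \<and> t < s then ?f t else 0))
    = (\<lambda>s. LINT t|lborel. indicator {0<..<s} t * ?f t)"
    by (intro ext Bochner_Integration.integral_cong) (auto simp: indicator_def)
  finally have "(\<lambda>s. LINT t|lborel. indicator {0<..<s} t * ?f t) \<in> borel_measurable unit_measure"
    by (intro measurable_restrict_space1) simp
  then show "(\<lambda>s. LBINT t:{0<..<s}. f t) \<in> borel_measurable unit_measure"
    by (subst measurable_cong[OF primitive_cong]) (auto simp: space_restrict_space)
  show "\<bar>LBINT t:{0<..<s}. f t\<bar> \<le> (LINT t|lborel. \<bar>?f t\<bar>)" if "s \<in> {0<..<1}" for s
  proof -
    note int = square_integrable_lborel[OF assms]
    have int': "integrable lborel (\<lambda>t. indicator {0<..<s} t * ?f t)"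
      by (rule Bochner_Integration.integrable_bound[OF int], measurable)
         (auto simp: indicator_def)
    have "norm (LINT t|lborel. indicator {0<..<s} t * ?f t)
        \<le> (LINT t|lborel. norm (indicator {0<..<s} t * ?f t))"
      by (rule integral_norm_bound)
    also have "\<dots> \<le> (LINT t|lborel. \<bar>?f t\<bar>)"
      by (rule integral_mono) (use int int' in \<open>auto simp: indicator_def\<close>)
    finally have "norm (LINT t|lborel. indicator {0<..<s} t * ?f t) \<le> (LINT t|lborel. \<bar>?f t\<bar>)" .
    then show ?thesis using primitive_cong[OF that] by simp
  qed
qed

lift_definition integration_op :: "L2_unit \<Rightarrow> L2_unit" is "\<lambda>x s. LBINT t:{0<..<s}. x t"
proof -
  fix f g :: "real \<Rightarrow> real"
  assume fg: "square_integrable f \<and> square_integrable g \<and> (AE t in unit_measure. f t = g t)"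
  then have *: "AE t in lborel. t \<in> {0<..<1} \<longrightarrow> f t = g t"
    by (simp add: AE_restrict_space_iff)
  have "(LBINT t:{0<..<s}. f t) = (LBINT t:{0<..<s}. g t)" if s: "s \<in> {0<..<1}" for s
    unfolding primitive_cong[OF s]
  proof (rule integral_cong_AE)
    have [measurable]: "(\<lambda>t. indicator {0<..<1} t * f t) \<in> borel_measurable borel"
      "(\<lambda>t. indicator {0<..<1} t * g t) \<in> borel_measurable borel"
      using fg borel_measurable_integrable[OF square_integrable_lborel] by auto
    show "(\<lambda>t. indicator {0<..<s} t * (indicator {0<..<1} t * f t)) \<in> borel_measurable lborel"
      "(\<lambda>t. indicator {0<..<s} t * (indicator {0<..<1} t * g t)) \<in> borel_measurable lborel"
      by simp_all
    show "AE t in lborel. indicator {0<..<s} t * (indicator {0<..<1} t * f t)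
        = indicator {0<..<s} t * (indicator {0<..<1} t * g t)"
      using * by (auto simp: indicator_def elim: eventually_mono)
  qed
  then have "AE s in unit_measure. (LBINT t:{0<..<s}. f t) = (LBINT t:{0<..<s}. g t)"
    by (intro AE_I2) (simp add: space_restrict_space)
  then show "square_integrable (\<lambda>s. LBINT t:{0<..<s}. f t) \<and>
      square_integrable (\<lambda>s. LBINT t:{0<..<s}. g t) \<and>
      (AE s in unit_measure. (LBINT t:{0<..<s}. f t) = (LBINT t:{0<..<s}. g t))"
    using fg square_integrable_primitive by blast
qed

text \<open>The moment sequence of a square-integrable function lies in \<open>\<ell>\<^sup>2\<close>, by a Schur test
  for the Hilbert matrix \<open>(1 / (j + k + 1))\<^sub>j\<^sub>k\<close>.\<close>

lemma hilbert_weight_step: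
  fixes p q :: real
  assumes "p \<ge> 1" "q \<ge> 1"
  shows "sqrt p / sqrt q / (p + q - 1)
    \<le> 8 * (sqrt q / (sqrt q + sqrt p) - sqrt (q - 1) / (sqrt (q - 1) + sqrt p))"
proof -
  define a b c where "a = sqrt p" and "b = sqrt q" and "c = sqrt (q - 1)"
  have a: "a \<ge> 1" "a\<^sup>2 = p" and b: "b \<ge> 1" "b\<^sup>2 = q" and c: "c \<ge> 0" "c\<^sup>2 = q - 1" and cb: "c \<le> b"
    using assms by (auto simp: a_def b_def c_def)
  have "(b - c) * (b + c) = 1" using b c by (simp add: algebra_simps power2_eq_square)
  then have bc: "b - c = 1 / (b + c)" using b c by (simp add: field_simps)
  have "b / (b + a) - c / (c + a) = a * (b - c) / ((b + a) * (c + a))"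
    using a b c by (simp add: field_simps)
  also have "\<dots> = a / ((b + c) * ((b + a) * (c + a)))"
    unfolding bc by simp
  also have "\<dots> \<ge> a / (2 * b * (2 * (p + q)))"
  proof (rule divide_left_mono)
    have "(b + a) * (c + a) \<le> (b + a) * (b + a)"
      using a b c cb by (intro mult_left_mono) auto
    also have "\<dots> \<le> 2 * (p + q)"
      using sum_squares_bound[of a b] a b by (simp add: algebra_simps power2_eq_square)
    finally have *: "(b + a) * (c + a) \<le> 2 * (p + q)" .
    show "(b + c) * ((b + a) * (c + a)) \<le> 2 * b * (2 * (p + q))"
      by (rule mult_mono[OF _ *]) (use a b c cb in auto)
  qed (use a b c assms in auto)
  finally have 1: "a / (2 * b * (2 * (p + q))) \<le> b / (b + a) - c / (c + a)" .
  have "a / b / (p + q - 1) \<le> a / b / ((p + q) / 2)"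
    using assms a b by (intro divide_left_mono) (auto intro!: divide_nonneg_nonneg mult_pos_pos)
  also have "\<dots> = 8 * (a / (2 * b * (2 * (p + q))))"
    using assms b by (simp add: divide_simps)
  also have "\<dots> \<le> 8 * (b / (b + a) - c / (c + a))"
    using 1 by (rule mult_left_mono) simp
  finally show ?thesis unfolding a_def b_def c_def .
qed

lemma sum_hilbert_weights:
  fixes p :: real
  assumes "p \<ge> 1"
  shows "(\<Sum>k<n. sqrt p / sqrt (real k + 1) / (p + real k)) \<le> 8"
proof -
  let ?g = "\<lambda>k. sqrt (real k) / (sqrt (real k) + sqrt p)"
  have "(\<Sum>k<n. sqrt p / sqrt (real k + 1) / (p + real k)) \<le> (\<Sum>k<n. 8 * (?g (Suc k) - ?g k))"
    using hilbert_weight_step[OF assms, of "real _ + 1"]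
    by (intro sum_mono) (simp add: add_ac)
  also have "\<dots> = 8 * ?g n"
    by (simp only: sum_distrib_left[symmetric] sum_lessThan_telescope[of ?g]) simp
  also have "\<dots> \<le> 8"
  proof -
    have "sqrt (real n) + sqrt p > 0"
      using assms by (simp add: add_nonneg_pos)
    then show ?thesis
      using assms by (simp add: divide_le_eq)
  qed
  finally show ?thesis .
qed

lemma hilbert_inequality:
  fixes a :: "nat \<Rightarrow> real"
  shows "(\<Sum>j<n. \<Sum>k<n. a j * a k / (real j + real k + 1)) \<le> 8 * (\<Sum>j<n. (a j)\<^sup>2)"
proof -
  let ?w = "\<lambda>j k. sqrt (real j + 1) / sqrt (real k + 1) / (real j + real k + 1)"
  have half: "(x + x) / 2 = x" for x :: real by simp
  have step: "a j * a k / (real j + real k + 1) \<le> ((a j)\<^sup>2 * ?w j k + (a k)\<^sup>2 * ?w k j) / 2" for j k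
  proof -
    define u v where "u = sqrt (real j + 1)" and "v = sqrt (real k + 1)"
    have uv: "u > 0" "v > 0" by (auto simp: u_def v_def)
    have "a j * a k \<le> ((a j)\<^sup>2 * (u / v) + (a k)\<^sup>2 * (v / u)) / 2"
    proof -
      have "0 \<le> (a j * u - a k * v)\<^sup>2 / (u * v)" using uv by simp
      also have "\<dots> = (a j)\<^sup>2 * (u / v) + (a k)\<^sup>2 * (v / u) - 2 * (a j * a k)"
        using uv by (simp add: field_simps power2_eq_square)
      finally show ?thesis by simp
    qed
    then have "a j * a k / (real j + real k + 1)
      \<le> ((a j)\<^sup>2 * (u / v) + (a k)\<^sup>2 * (v / u)) / 2 / (real j + real k + 1)"
      by (rule divide_right_mono) simp
    also have "\<dots> = ((a j)\<^sup>2 * ?w j k + (a k)\<^sup>2 * ?w k j) / 2"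
      unfolding u_def[symmetric] v_def[symmetric]
      by (simp add: add_divide_distrib add.commute mult_ac)
    finally show ?thesis .
  qed
  have "(\<Sum>j<n. \<Sum>k<n. a j * a k / (real j + real k + 1))
    \<le> (\<Sum>j<n. \<Sum>k<n. ((a j)\<^sup>2 * ?w j k + (a k)\<^sup>2 * ?w k j) / 2)"
    by (intro sum_mono step)
  also have "\<dots> = ((\<Sum>j<n. \<Sum>k<n. (a j)\<^sup>2 * ?w j k) + (\<Sum>j<n. \<Sum>k<n. (a k)\<^sup>2 * ?w k j)) / 2"
    by (simp only: sum_divide_distrib[symmetric] sum.distrib)
  also have "(\<Sum>j<n. \<Sum>k<n. (a k)\<^sup>2 * ?w k j) = (\<Sum>j<n. \<Sum>k<n. (a j)\<^sup>2 * ?w j k)"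
    by (rule sum.swap)
  also have "((\<Sum>j<n. \<Sum>k<n. (a j)\<^sup>2 * ?w j k) + (\<Sum>j<n. \<Sum>k<n. (a j)\<^sup>2 * ?w j k)) / 2
    = (\<Sum>j<n. (a j)\<^sup>2 * (\<Sum>k<n. ?w j k))"
    unfolding half sum_distrib_left ..
  also have "\<dots> \<le> (\<Sum>j<n. (a j)\<^sup>2 * 8)"
  proof (intro sum_mono mult_left_mono)
    show "(\<Sum>k<n. ?w j k) \<le> 8" for j
      using sum_hilbert_weights[of "real j + 1" n] by (simp add: add_ac)
  qed simp
  finally show ?thesis by (simp add: sum_distrib_left mult.commute)
qed

lemma integral_unit_power: "(LINT t|unit_measure. t ^ k) = 1 / (real k + 1)"
proof -
  have "(LINT t|unit_measure. t ^ k) = (LINT t|lborel. t ^ k * indicator {0..1} t)"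
  proof -
    have "(LINT t|unit_measure. t ^ k) = (LINT t|lborel. indicator {0<..<1} t *\<^sub>R t ^ k)"
      by (simp add: integral_restrict_space)
    also have "\<dots> = (LINT t|lborel. t ^ k * indicator {0..1} t)"
    proof (rule integral_cong_AE)
      show "AE t in lborel. indicator {0<..<1} t *\<^sub>R t ^ k = t ^ k * indicator {0..1::real} t"
        using AE_lborel_singleton[of 0] AE_lborel_singleton[of 1]
        by eventually_elim (auto simp: indicator_def)
    qed simp_all
    finally show "(LINT t|unit_measure. t ^ k) = (LINT t|lborel. t ^ k * indicator {0..1} t)" .
  qed
  then show ?thesis by (simp add: integral_power add.commute)
qed

lemma summable_moments:
  assumes f: "square_integrable f"
  shows "summable (\<lambda>j. (LINT t|unit_measure. t ^ j * f t)\<^sup>2)"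
proof -
  define a where "a j = (LINT t|unit_measure. t ^ j * f t)" for j
  have int: "integrable unit_measure (\<lambda>t. t ^ j * f t)" for j
    by (rule square_integrable_mult[OF square_integrable_power f])
  have int': "integrable unit_measure (\<lambda>t. t ^ j)" for j :: nat
    by (rule square_integrable_integrable[OF square_integrable_power])
  have f2: "integrable unit_measure (\<lambda>t. (f t)\<^sup>2)"
    using f by (simp add: square_integrable_def)
  have bound: "(\<Sum>j<n. (a j)\<^sup>2) \<le> 8 * (LINT t|unit_measure. (f t)\<^sup>2)" for n
  proof -
    define p where "p t = (\<Sum>j<n. a j * t ^ j)" for t :: real
    have p2: "(p t)\<^sup>2 = (\<Sum>j<n. \<Sum>k<n. a j * a k * t ^ (j + k))" for t
      by (simp add: p_def power2_eq_square sum_product power_add algebra_simps)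
    have pf: "p t * f t = (\<Sum>j<n. a j * (t ^ j * f t))" for t
      by (simp add: p_def sum_distrib_right mult.assoc)
    have intp2: "integrable unit_measure (\<lambda>t. (p t)\<^sup>2)"
      unfolding p2 by (intro Bochner_Integration.integrable_sum integrable_mult_right int')
    have intpf: "integrable unit_measure (\<lambda>t. p t * f t)"
      unfolding pf by (intro Bochner_Integration.integrable_sum integrable_mult_right int)
    have "(\<Sum>j<n. (a j)\<^sup>2) = (LINT t|unit_measure. p t * f t)"
      unfolding pf by (simp add: int power2_eq_square a_def)
    also have "\<dots> \<le> (LINT t|unit_measure. (p t)\<^sup>2 / 16 + 4 * (f t)\<^sup>2)"
    proof (rule integral_mono)
      show "integrable unit_measure (\<lambda>t. (p t)\<^sup>2 / 16 + 4 * (f t)\<^sup>2)"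
        using intp2 f2 by auto
      fix t :: real
      have "0 \<le> (p t / 4 - 2 * f t)\<^sup>2" by simp
      then show "p t * f t \<le> (p t)\<^sup>2 / 16 + 4 * (f t)\<^sup>2"
        by (simp add: power2_eq_square algebra_simps)
    qed (rule intpf)
    also have "\<dots> = (LINT t|unit_measure. (p t)\<^sup>2) / 16 + 4 * (LINT t|unit_measure. (f t)\<^sup>2)"
      using intp2 f2 by simp
    also have "(LINT t|unit_measure. (p t)\<^sup>2) = (\<Sum>j<n. \<Sum>k<n. a j * a k / (real j + real k + 1))"
      unfolding p2 by (simp add: int' integral_unit_power)
    also have "\<dots> \<le> 8 * (\<Sum>j<n. (a j)\<^sup>2)" by (rule hilbert_inequality)
    finally show ?thesis by simp
  qed
  have "summable (\<lambda>j. (a j)\<^sup>2)"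
    using bound by (intro bounded_imp_summable[where B = "8 * (LINT t|unit_measure. (f t)\<^sup>2)"])
       (simp_all only: lessThan_Suc_atMost[symmetric] zero_le_power2)
  then show ?thesis by (simp add: a_def)
qed

text \<open>Coordinate \<open>j\<close> is the moment of order \<open>j\<close>, since sequences are indexed from \<open>0\<close>.\<close>

lift_definition hausdorff_op :: "L2_unit \<Rightarrow> ell2" is "\<lambda>z j. LINT t|unit_measure. t ^ j * z t"
proof (intro conjI ext)
  fix f g :: "real \<Rightarrow> real" and j :: nat
  assume fg: "square_integrable f \<and> square_integrable g \<and> (AE t in unit_measure. f t = g t)"
  then show "summable (\<lambda>j. (LINT t|unit_measure. t ^ j * f t)\<^sup>2)"
    by (simp add: summable_moments)
  show "(LINT t|unit_measure. t ^ j * f t) = (LINT t|unit_measure. t ^ j * g t)"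
    using fg square_integrable_power[of j] unfolding square_integrable_def
    by (intro integral_cong_AE borel_measurable_times) (auto elim: eventually_mono)
qed

section \<open>Singular values\<close>

definition singular_space :: "('a::real_inner \<Rightarrow> 'b::real_inner) \<Rightarrow> real \<Rightarrow> 'a set"
  where "singular_space T s = {u. adjoint T (T u) = s\<^sup>2 *\<^sub>R u}"

text \<open>The \<open>i\<close>-th entry (\<open>i \<ge> 1\<close>) of the list of singular values is the largest \<open>s > 0\<close> such that at
  least \<open>i\<close> singular values, counted with multiplicity, are \<open>\<ge> s\<close>, and \<open>0\<close> if there is no such \<open>s\<close>.
  Eigenvectors of \<open>T\<^sup>* T\<close> for different eigenvalues are independent, so an independent set of
  eigenvectors counts multiplicities. The value at \<open>i = 0\<close> has no meaning.
  The three lemmas closing this section show that, for a compact operator, this is the list of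
  singular values in non-increasing order with multiplicity.\<close>

definition singular_value :: "('a::real_inner \<Rightarrow> 'b::real_inner) \<Rightarrow> nat \<Rightarrow> real"
  where "singular_value T i =
    Sup (insert 0 {s. 0 < s \<and>
      (\<exists>U. finite U \<and> card U = i \<and> independent U \<and> U \<subseteq> (\<Union>t\<in>{s..}. singular_space T t))})"

definition orthonormal :: "'a::real_inner set \<Rightarrow> bool"
  where "orthonormal F \<longleftrightarrow> (\<forall>u\<in>F. norm u = 1) \<and> pairwise (\<lambda>u v. inner u v = 0) F"

lemma orthonormal_independent:
  assumes "orthonormal F"
  shows "independent F"
  using assms pairwise_orthogonal_independent[of F]
  by (force simp: orthonormal_def pairwise_def orthogonal_def)

lemma orthonormal_inner:
  assumes "orthonormal F" "finite F" "g \<in> F"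
  shows "inner (\<Sum>f\<in>F. c f *\<^sub>R f) g = c g"
proof -
  have "inner (\<Sum>f\<in>F. c f *\<^sub>R f) g = (\<Sum>f\<in>F. if f = g then c g else 0)"
    unfolding inner_sum_left
    by (rule sum.cong)
       (use assms in \<open>auto simp: orthonormal_def pairwise_def power2_norm_eq_inner[symmetric]\<close>)
  then show ?thesis using assms by simp
qed

lemma orthonormal_expansion:
  assumes "orthonormal F" "finite F" "u \<in> span F"
  shows "u = (\<Sum>f\<in>F. inner u f *\<^sub>R f)"
proof -
  obtain c where c: "u = (\<Sum>f\<in>F. c f *\<^sub>R f)"
    using assms(3) by (auto simp: span_finite[OF assms(2)])
  have "inner u f = c f" if "f \<in> F" for f
    unfolding c by (rule orthonormal_inner[OF assms(1,2) that])
  then show ?thesis using c by simp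
qed

context
  fixes T :: "'a::real_inner \<Rightarrow> 'b::real_inner"
  assumes lin: "linear T"
    and adj: "\<And>x y. inner (T x) y = inner x (adjoint T y)"
    and comp: "compact (closure (T ` cball 0 1))"
begin

lemma singular_space_iff: "u \<in> singular_space T s \<longleftrightarrow> (\<forall>v. inner (T u) (T v) = s\<^sup>2 * inner u v)"
proof -
  have "u \<in> singular_space T s \<longleftrightarrow> (\<forall>v. inner v (adjoint T (T u)) = inner v (s\<^sup>2 *\<^sub>R u))"
    unfolding singular_space_def mem_Collect_eq by (rule vector_eq_ldot[symmetric])
  also have "\<dots> \<longleftrightarrow> (\<forall>v. inner (T v) (T u) = s\<^sup>2 * inner v u)"
    by (simp add: adj)
  finally show ?thesis by (simp add: inner_commute)
qed

lemma subspace_singular_space: "subspace (singular_space T s)"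
  unfolding subspace_def
  by (auto simp: singular_space_iff linear_0[OF lin] linear_add[OF lin] linear_scale[OF lin] inner_left_distrib
      algebra_simps)

lemma singular_space_orthogonal:
  assumes "u \<in> singular_space T s" "v \<in> singular_space T t" "s\<^sup>2 \<noteq> t\<^sup>2"
  shows "inner u v = 0"
proof -
  have "s\<^sup>2 * inner u v = inner (T u) (T v)"
    using assms(1) by (simp add: singular_space_iff)
  also have "\<dots> = inner (T v) (T u)" by (rule inner_commute)
  also have "\<dots> = t\<^sup>2 * inner u v"
    using assms(2) by (simp add: singular_space_iff inner_commute)
  finally show ?thesis using assms(3) by simp
qed

lemma orthonormal_extend:
  assumes F: "finite F" "orthonormal F" "F \<subseteq> (\<Union>t\<in>{s..}. singular_space T t)"
    and s: "0 < s" and nspan: "\<not> (\<Union>t\<in>{s..}. singular_space T t) \<subseteq> span F"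
  shows "\<exists>e. e \<in> (\<Union>t\<in>{s..}. singular_space T t) \<and> norm e = 1 \<and> (\<forall>f\<in>F. inner e f = 0)"
proof -
  obtain u t where u: "u \<in> singular_space T t" "t \<ge> s" "u \<notin> span F"
    using nspan by auto
  define w where "w = (\<Sum>f\<in>F. inner u f *\<^sub>R f)"
  have "inner u f *\<^sub>R f \<in> singular_space T t" if f: "f \<in> F" for f
  proof -
    obtain r where r: "f \<in> singular_space T r" "r \<ge> s" using F f by auto
    show ?thesis
    proof (cases "r = t")
      case True
      then show ?thesis using r subspace_scale[OF subspace_singular_space] by simp
    next
      case False
      then have "t\<^sup>2 \<noteq> r\<^sup>2" using r u s by simp
      then show ?thesis
        using singular_space_orthogonal[OF u(1) r(1)] subspace_0[OF subspace_singular_space] by simp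
    qed
  qed
  then have "w \<in> singular_space T t"
    unfolding w_def by (intro subspace_sum subspace_singular_space)
  then have v: "u - w \<in> singular_space T t"
    using u(1) by (intro subspace_diff subspace_singular_space)
  have "w \<in> span F" unfolding w_def by (intro span_sum span_scale span_base)
  then have "u - w \<noteq> 0" using u(3) by auto
  moreover have "inner (u - w) f = 0" if "f \<in> F" for f
    using orthonormal_inner[OF F(2,1) that, of "inner u"] by (simp add: w_def inner_diff_left)
  ultimately show ?thesis
    using v u(2) subspace_scale[OF subspace_singular_space v]
    by (intro exI[of _ "(u - w) /\<^sub>R norm (u - w)"]) auto
qed

lemma singular_space_basis:
  assumes s: "0 < s"
  shows "\<exists>F. finite F \<and> orthonormal F \<and> F \<subseteq> (\<Union>t\<in>{s..}. singular_space T t)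
    \<and> (\<Union>t\<in>{s..}. singular_space T t) \<subseteq> span F"
proof (rule ccontr)
  assume none: "\<not> ?thesis"
  let ?A = "\<Union>t\<in>{s..}. singular_space T t"
  define good where "good F \<longleftrightarrow> finite F \<and> orthonormal F \<and> F \<subseteq> ?A" for F
  have "\<forall>F. good F \<longrightarrow> (\<exists>e. e \<in> ?A \<and> norm e = 1 \<and> (\<forall>f\<in>F. inner e f = 0))"
    using none orthonormal_extend[OF _ _ _ s] unfolding good_def by blast
  then obtain pick where pick:
    "\<And>F. good F \<Longrightarrow> pick F \<in> ?A" "\<And>F. good F \<Longrightarrow> norm (pick F) = 1"
    "\<And>F f. good F \<Longrightarrow> f \<in> F \<Longrightarrow> inner (pick F) f = 0"
    by metis
  define G where "G = rec_nat {} (\<lambda>_ F. insert (pick F) F)"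
  have G_Suc: "G (Suc n) = insert (pick (G n)) (G n)" for n by (simp add: G_def)
  have good: "good (G n)" for n
  proof (induction n)
    case 0
    show ?case by (simp add: G_def good_def orthonormal_def)
  next
    case (Suc n)
    show ?case
      using Suc pick[OF Suc] unfolding G_Suc
      by (auto simp: good_def orthonormal_def pairwise_insert inner_commute)
  qed
  have "m < n \<Longrightarrow> pick (G m) \<in> G n" for m n
    by (induction n) (auto simp: G_Suc less_Suc_eq)
  then have orth: "inner (pick (G n)) (pick (G m)) = 0" if "m < n" for m n
    using pick(3)[OF good] that by blast
  define e where "e n = pick (G n)" for n
  have sep: "s \<le> dist (T (e m)) (T (e n))" if "m < n" for m n
  proof -
    obtain t r where t: "e m \<in> singular_space T t" "t \<ge> s" and r: "e n \<in> singular_space T r" "r \<ge> s"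
      using pick(1)[OF good] unfolding e_def by (metis UN_E atLeast_iff)
    have "(dist (T (e m)) (T (e n)))\<^sup>2 = inner (T (e m)) (T (e m)) + inner (T (e n)) (T (e n))
        - 2 * inner (T (e m)) (T (e n))"
      by (simp add: dist_norm power2_norm_eq_inner inner_diff inner_commute)
    also have "\<dots> = t\<^sup>2 + r\<^sup>2"
    proof -
      have "inner (e k) (e k) = 1" for k
        using pick(2)[OF good, of k] by (simp add: e_def power2_norm_eq_inner[symmetric])
      moreover have "inner (e m) (e n) = 0"
        using orth[OF that] by (simp add: e_def inner_commute)
      ultimately show ?thesis
        using t(1) r(1) unfolding singular_space_iff by simp
    qed
    also have "\<dots> \<ge> s\<^sup>2"
      using power_mono[of s t 2] t s by (simp add: add_increasing2)
    finally show ?thesis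
      by (rule power2_le_imp_le) simp
  qed
  have "T (e n) \<in> closure (T ` cball 0 1)" for n
    using pick(2)[OF good] by (intro closure_subset[THEN subsetD] imageI) (simp add: e_def)
  then obtain l r where "strict_mono (r :: nat \<Rightarrow> nat)" "((\<lambda>n. T (e n)) \<circ> r) \<longlonglongrightarrow> l"
    using comp unfolding compact_def by metis
  then have "Cauchy ((\<lambda>n. T (e n)) \<circ> r)" by (intro LIMSEQ_imp_Cauchy)
  then obtain M where "\<forall>m\<ge>M. \<forall>n\<ge>M. dist (T (e (r m))) (T (e (r n))) < s"
    using s unfolding Cauchy_def by auto
  then have "dist (T (e (r M))) (T (e (r (Suc M)))) < s" by simp
  moreover have "r M < r (Suc M)" using \<open>strict_mono r\<close> by (simp add: strict_mono_Suc_iff)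
  ultimately show False using sep by fastforce
qed

lemma singular_value_count:
  assumes "0 < s0"
  obtains F :: "'a set" and \<tau> where "finite F"
    and "\<And>s. s0 \<le> s \<Longrightarrow> dim (singular_space T s) = card {f \<in> F. \<tau> f = s}"
    and "\<And>s i. s0 < s \<Longrightarrow> 1 \<le> i \<Longrightarrow> s \<le> singular_value T i \<longleftrightarrow> i \<le> card {f \<in> F. s \<le> (\<tau> f :: real)}"
    and "\<And>i. 1 \<le> i \<Longrightarrow> bdd_above (insert 0 {s. 0 < s \<and>
      (\<exists>U. finite U \<and> card U = i \<and> independent U \<and> U \<subseteq> (\<Union>t\<in>{s..}. singular_space T t))})"
proof -
  let ?A = "\<lambda>s. \<Union>t\<in>{s..}. singular_space T t"
  obtain F where F: "finite F" "orthonormal F" "F \<subseteq> ?A s0" "?A s0 \<subseteq> span F"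
    using singular_space_basis[OF assms] by blast
  then have "\<forall>f\<in>F. \<exists>t. s0 \<le> t \<and> f \<in> singular_space T t" by auto
  then obtain \<tau> where \<tau>: "\<And>f. f \<in> F \<Longrightarrow> s0 \<le> \<tau> f" "\<And>f. f \<in> F \<Longrightarrow> f \<in> singular_space T (\<tau> f)"
    by metis
  have unique: "\<tau> f = t" if "f \<in> F" "f \<in> singular_space T t" "s0 \<le> t" for f t
  proof (rule ccontr)
    assume "\<tau> f \<noteq> t"
    then have "(\<tau> f)\<^sup>2 \<noteq> t\<^sup>2" using assms \<tau>(1)[OF that(1)] that(3) by simp
    then have "inner f f = 0"
      by (rule singular_space_orthogonal[OF \<tau>(2)[OF that(1)] that(2)])
    then show False using F(2) that(1) by (auto simp: orthonormal_def)
  qed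
  have expand: "u \<in> span {f \<in> F. \<tau> f = t}" if u: "u \<in> singular_space T t" "s0 \<le> t" for u t
  proof -
    have "u = (\<Sum>f\<in>F. inner u f *\<^sub>R f)"
      using F(4) u by (intro orthonormal_expansion F) auto
    also have "\<dots> \<in> span {f \<in> F. \<tau> f = t}"
    proof (rule span_sum)
      fix f assume f: "f \<in> F"
      show "inner u f *\<^sub>R f \<in> span {f \<in> F. \<tau> f = t}"
      proof (cases "\<tau> f = t")
        case True
        then show ?thesis using f by (intro span_scale span_base) auto
      next
        case False
        then have "t\<^sup>2 \<noteq> (\<tau> f)\<^sup>2" using assms \<tau>(1)[OF f] u(2) by simp
        then show ?thesis
          using singular_space_orthogonal[OF u(1) \<tau>(2)[OF f]] by (simp add: span_zero)
      qed
    qed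
    finally show ?thesis .
  qed
  have indep: "independent G" if "G \<subseteq> F" for G
    using orthonormal_independent[OF F(2)] that by (rule independent_mono)
  have dim: "dim (singular_space T s) = card {f \<in> F. \<tau> f = s}" if "s0 \<le> s" for s
    by (rule dim_unique) (use \<tau> expand[OF _ that] indep in auto)
  let ?n = "\<lambda>s. card {f \<in> F. s \<le> \<tau> f}"
  have count: "(\<exists>U. finite U \<and> card U = i \<and> independent U \<and> U \<subseteq> ?A s) \<longleftrightarrow> i \<le> ?n s"
    if s: "s0 \<le> s" for s i
  proof
    assume "\<exists>U. finite U \<and> card U = i \<and> independent U \<and> U \<subseteq> ?A s"
    then obtain U where U: "finite U" "card U = i" "independent U" "U \<subseteq> ?A s" by blast
    have "U \<subseteq> span {f \<in> F. s \<le> \<tau> f}"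
    proof
      fix u assume "u \<in> U"
      then obtain t where t: "s \<le> t" "u \<in> singular_space T t" using U by auto
      then have "u \<in> span {f \<in> F. \<tau> f = t}" using s by (intro expand) auto
      then show "u \<in> span {f \<in> F. s \<le> \<tau> f}"
        using t span_mono[of "{f \<in> F. \<tau> f = t}" "{f \<in> F. s \<le> \<tau> f}"] by auto
    qed
    then show "i \<le> ?n s"
      using independent_span_bound[of "{f \<in> F. s \<le> \<tau> f}" U] U F(1) by simp
  next
    assume "i \<le> ?n s"
    then obtain U where U: "U \<subseteq> {f \<in> F. s \<le> \<tau> f}" "card U = i"
      by (meson obtain_subset_with_card_n)
    then have "finite U" "independent U" "U \<subseteq> ?A s"
      using F(1) finite_subset[OF U(1)] indep[of U] \<tau> by auto
    then show "\<exists>U. finite U \<and> card U = i \<and> independent U \<and> U \<subseteq> ?A s" using U by blast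
  qed
  have *: "(s0 < s \<longrightarrow> (s \<le> singular_value T i \<longleftrightarrow> i \<le> ?n s)) \<and> bdd_above (insert 0 {s. 0 < s \<and>
      (\<exists>U. finite U \<and> card U = i \<and> independent U \<and> U \<subseteq> ?A s)})" if i: "1 \<le> i" for s i
  proof -
    define S where "S = insert 0 {s. 0 < s \<and>
      (\<exists>U. finite U \<and> card U = i \<and> independent U \<and> U \<subseteq> ?A s)}"
    have S: "t \<in> S \<longleftrightarrow> i \<le> ?n t" if "s0 \<le> t" for t
      using that assms count[OF that] by (auto simp: S_def)
    have mono: "?n t \<le> ?n t'" if "t' \<le> t" for t t'
      using F(1) that by (intro card_mono) auto
    have upper: "Sup S \<le> b" if b: "s0 \<le> b" "\<And>t. b < t \<Longrightarrow> ?n t < i" for b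
    proof (rule cSup_least)
      show "S \<noteq> {}" by (simp add: S_def)
      show "t \<le> b" if "t \<in> S" for t
        using S[of t] b that by (meson leD le_less_linear less_imp_le order_less_le_trans)
    qed
    have bdd: "bdd_above S"
    proof (rule bdd_aboveI)
      fix t assume t: "t \<in> S"
      show "t \<le> Max (insert s0 (\<tau> ` F))"
      proof (cases "s0 \<le> t")
        case True
        then have "{f \<in> F. t \<le> \<tau> f} \<noteq> {}" using S[of t] t i by (metis card.empty not_one_le_zero order_trans)
        then show ?thesis using F(1) by (auto intro: Max_ge_iff[THEN iffD2])
      qed (use F(1) in \<open>auto intro: Max_ge_iff[THEN iffD2]\<close>)
    qed
    have "s \<le> Sup S \<longleftrightarrow> i \<le> ?n s" if s: "s0 < s"
    proof
      assume "i \<le> ?n s"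
      then show "s \<le> Sup S" using S[of s] s bdd by (intro cSup_upper) auto
    next
      assume le: "s \<le> Sup S"
      show "i \<le> ?n s"
      proof (rule ccontr)
        assume n: "\<not> i \<le> ?n s"
        define b where "b = Max (insert s0 {t \<in> \<tau> ` F. t < s})"
        have fin: "finite (insert s0 {t \<in> \<tau> ` F. t < s})" using F(1) by auto
        have b: "b < s" "s0 \<le> b" using fin s by (auto simp: b_def)
        have "?n t < i" if "b < t" for t
        proof -
          have "s \<le> \<tau> f" if "f \<in> F" "t \<le> \<tau> f" for f
          proof (rule ccontr)
            assume "\<not> s \<le> \<tau> f"
            then have "\<tau> f \<le> b" unfolding b_def using fin that by (intro Max_ge) auto
            then show False using \<open>b < t\<close> that by simp
          qed
          then have "?n t \<le> ?n s" using F(1) by (intro card_mono) auto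
          then show ?thesis using n by simp
        qed
        then have "Sup S \<le> b" by (intro upper b)
        then show False using le b by simp
      qed
    qed
    then show ?thesis using bdd by (simp add: singular_value_def S_def)
  qed
  show thesis by (rule that[of F \<tau>, OF F(1) dim]) (use * in auto)
qed

lemma singular_value_nonneg:
  assumes "1 \<le> i"
  shows "0 \<le> singular_value T i"
proof -
  obtain F :: "'a set" and \<tau> where "finite F"
    and "\<And>r. 1 \<le> r \<Longrightarrow> dim (singular_space T r) = card {f \<in> F. \<tau> f = r}"
    and "\<And>r i. 1 < r \<Longrightarrow> 1 \<le> i \<Longrightarrow>
      r \<le> singular_value T i \<longleftrightarrow> i \<le> card {f \<in> F. r \<le> (\<tau> f :: real)}"
    and bdd: "\<And>i. 1 \<le> i \<Longrightarrow> bdd_above (insert 0 {s. 0 < s \<and>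
      (\<exists>U. finite U \<and> card U = i \<and> independent U \<and> U \<subseteq> (\<Union>t\<in>{s..}. singular_space T t))})"
  proof (rule singular_value_count[OF zero_less_one], goal_cases)
    case (1 F \<tau>)
    show ?case by (rule 1(1)[OF 1(2-5)])
  qed
  show ?thesis unfolding singular_value_def by (rule cSup_upper[OF _ bdd[OF assms]]) simp
qed

lemma singular_value_antimono:
  assumes "1 \<le> i" "i \<le> j"
  shows "singular_value T j \<le> singular_value T i"
proof (rule ccontr)
  assume "\<not> ?thesis"
  then have less: "singular_value T i < singular_value T j" by simp
  then have pos: "0 < singular_value T j" using singular_value_nonneg[OF assms(1)] by simp
  obtain F :: "'a set" and \<tau> where "finite F"
    and "\<And>r. singular_value T j / 2 \<le> r \<Longrightarrow> dim (singular_space T r) = card {f \<in> F. \<tau> f = r}"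
    and count: "\<And>r i. singular_value T j / 2 < r \<Longrightarrow> 1 \<le> i \<Longrightarrow>
      r \<le> singular_value T i \<longleftrightarrow> i \<le> card {f \<in> F. r \<le> (\<tau> f :: real)}"
    and "\<And>i. 1 \<le> i \<Longrightarrow> bdd_above (insert 0 {s. 0 < s \<and>
      (\<exists>U. finite U \<and> card U = i \<and> independent U \<and> U \<subseteq> (\<Union>t\<in>{s..}. singular_space T t))})"
  proof (rule singular_value_count[OF half_gt_zero[OF pos]], goal_cases)
    case (1 F \<tau>)
    show ?case by (rule 1(1)[OF 1(2-5)])
  qed
  from count[of "singular_value T j" j] count[of "singular_value T j" i]
  show False using pos assms less by simp
qed

lemma card_singular_value_eq:
  assumes "0 < s"
  shows "finite {i. 1 \<le> i \<and> singular_value T i = s}"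
    and "card {i. 1 \<le> i \<and> singular_value T i = s} = dim (singular_space T s)"
proof -
  obtain F :: "'a set" and \<tau> where F: "finite F"
    and dim: "\<And>r. s / 2 \<le> r \<Longrightarrow> dim (singular_space T r) = card {f \<in> F. \<tau> f = r}"
    and count: "\<And>r i. s / 2 < r \<Longrightarrow> 1 \<le> i \<Longrightarrow>
      r \<le> singular_value T i \<longleftrightarrow> i \<le> card {f \<in> F. r \<le> (\<tau> f :: real)}"
    and "\<And>i. 1 \<le> i \<Longrightarrow> bdd_above (insert 0 {s. 0 < s \<and>
      (\<exists>U. finite U \<and> card U = i \<and> independent U \<and> U \<subseteq> (\<Union>t\<in>{s..}. singular_space T t))})"
  proof (rule singular_value_count[OF half_gt_zero[OF assms]], goal_cases)
    case (1 F \<tau>)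
    show ?case by (rule 1(1)[OF 1(2-5)])
  qed
  have greater: "s < singular_value T i \<longleftrightarrow> i \<le> card {f \<in> F. s < \<tau> f}" if i: "1 \<le> i" for i
  proof
    assume less: "s < singular_value T i"
    then have "i \<le> card {f \<in> F. singular_value T i \<le> \<tau> f}"
      using count[of "singular_value T i" i] i assms by simp
    also have "\<dots> \<le> card {f \<in> F. s < \<tau> f}"
      using F less by (intro card_mono) auto
    finally show "i \<le> card {f \<in> F. s < \<tau> f}" .
  next
    assume le: "i \<le> card {f \<in> F. s < \<tau> f}"
    then have ne: "{f \<in> F. s < \<tau> f} \<noteq> {}" using i by (metis card.empty not_one_le_zero order_trans)
    define r where "r = Min (\<tau> ` {f \<in> F. s < \<tau> f})"
    have r: "s < r" unfolding r_def using F ne by (subst Min_gr_iff) auto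
    have "{f \<in> F. s < \<tau> f} \<subseteq> {f \<in> F. r \<le> \<tau> f}" unfolding r_def using F by auto
    then have "i \<le> card {f \<in> F. r \<le> \<tau> f}"
      using le card_mono[of "{f \<in> F. r \<le> \<tau> f}" "{f \<in> F. s < \<tau> f}"] F by simp
    then have "r \<le> singular_value T i" using count[of r i] r i assms by simp
    then show "s < singular_value T i" using r by simp
  qed
  have eq: "{i. 1 \<le> i \<and> singular_value T i = s} = {card {f \<in> F. s < \<tau> f}<..card {f \<in> F. s \<le> \<tau> f}}"
  proof (rule set_eqI)
    fix i
    show "i \<in> {i. 1 \<le> i \<and> singular_value T i = s}
      \<longleftrightarrow> i \<in> {card {f \<in> F. s < \<tau> f}<..card {f \<in> F. s \<le> \<tau> f}}"
    proof (cases "1 \<le> i")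
      case True
      have "singular_value T i = s \<longleftrightarrow> s \<le> singular_value T i \<and> \<not> s < singular_value T i"
        by auto
      also have "\<dots> \<longleftrightarrow> i \<le> card {f \<in> F. s \<le> \<tau> f} \<and> \<not> i \<le> card {f \<in> F. s < \<tau> f}"
        using greater[OF True] count[OF _ True, of s] assms by simp
      finally show ?thesis using True by (simp add: not_le conj_commute)
    qed simp
  qed
  show "finite {i. 1 \<le> i \<and> singular_value T i = s}" unfolding eq by simp
  have "{f \<in> F. s \<le> \<tau> f} = {f \<in> F. s < \<tau> f} \<union> {f \<in> F. \<tau> f = s}" by auto
  then have "card {f \<in> F. s \<le> \<tau> f} = card {f \<in> F. s < \<tau> f} + card {f \<in> F. \<tau> f = s}"
    using F by (auto intro!: card_Un_disjoint)
  then show "card {i. 1 \<le> i \<and> singular_value T i = s} = dim (singular_space T s)"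
    unfolding eq using dim[of s] assms by simp
qed

end

end

theory Submission
  imports Defs
begin

text \<open>Write \<open>A = B \<circ> J\<close>. Its \<open>k\<close>-th coordinate is the inner product with
  \<open>J\<^sup>* t\<^sup>k = (1 - t\<^sup>k\<^sup>+\<^sup>1) / (k + 1)\<close>. Modulo the space spanned by
  \<open>1, t, \<dots>, t\<^sup>n\<close>, these vectors vanish for \<open>k < n\<close> and have squared norm at most
  \<open>1 / ((k + 1)\<^sup>2 (2 k + 3))\<close> for \<open>k \<ge> n\<close>. Hence \<open>A\<close> is within Hilbert-Schmidt distance
  \<open>1 / n\<close> of an operator of rank \<open>n + 1\<close>, and \<open>i\<close> orthonormal singular vectors with singular values
  \<open>\<ge> s\<close> satisfy \<open>s (i - n - 1) \<le> \<surd>i / n\<close>; take \<open>n\<close> about \<open>i / 2\<close>. The ratio bound follows because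
  the functions \<open>cos ((k + 1/2) \<pi> t)\<close> are singular vectors of \<open>J\<close> with singular values
  \<open>1 / ((k + 1/2) \<pi>)\<close>.\<close>

section \<open>Singular vectors and finite-rank approximation\<close>

text \<open>Gram-Schmidt stays among the eigenvectors: the projection \<open>w\<close> of
  \<open>u\<close> onto the earlier vectors uses only vectors with the eigenvalue of
  \<open>u\<close>, so \<open>u - w\<close> is again an eigenvector for that eigenvalue. Equality of
  the spans is the invariant that carries \<open>u \<notin> span U\<close> over to
  \<open>F\<close>.\<close>

lemma orthonormal_eigenvectors:
  fixes T :: "'a::real_inner \<Rightarrow> 'b::real_inner"
  assumes "linear T" "finite U" "independent U"
    and "\<And>u. u \<in> U \<Longrightarrow> \<exists>t\<ge>s. \<forall>v. inner (T u) (T v) = t\<^sup>2 * inner u v"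
  shows "\<exists>F. finite F \<and> card F = card U \<and> orthonormal F \<and> span F = span U \<and>
    (\<forall>f\<in>F. \<exists>t\<ge>s. \<forall>v. inner (T f) (T v) = t\<^sup>2 * inner f v)"
  using assms(2-4)
proof (induction U rule: finite_induct)
  case empty
  show ?case by (rule exI[of _ "{}"]) (simp add: orthonormal_def)
next
  case (insert u U)
  have u: "u \<notin> span U" and "independent U"
    using insert.prems(1) insert.hyps(2) by (auto simp: independent_insert)
  then obtain F where F: "finite F" "card F = card U" "orthonormal F" "span F = span U"
    and eig: "\<forall>f\<in>F. \<exists>t\<ge>s. \<forall>v. inner (T f) (T v) = t\<^sup>2 * inner f v"
    using insert.IH insert.prems(2) by auto
  obtain t where t: "t \<ge> s" "\<And>v. inner (T u) (T v) = t\<^sup>2 * inner u v"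
    using insert.prems(2)[of u] by auto
  define w where "w = (\<Sum>f\<in>F. inner u f *\<^sub>R f)"
  have Tw: "T w = (\<Sum>f\<in>F. inner u f *\<^sub>R T f)"
    unfolding w_def by (simp add: linear_sum[OF assms(1)] linear_scale[OF assms(1)])
  \<comment> \<open>Testing each eigenvector equation against the other vector gives (t^2 - r^2) <u,
    f> = 0: either the component vanishes or the eigenvalues agree.\<close>
  have "inner u f * inner (T f) (T v) = t\<^sup>2 * (inner u f * inner f v)" if f: "f \<in> F" for f v
  proof -
    obtain r where r: "\<And>v. inner (T f) (T v) = r\<^sup>2 * inner f v" using eig f by blast
    have "t\<^sup>2 * inner u f = r\<^sup>2 * inner u f"
      using t(2)[of f] r[of u] by (simp only: inner_commute)
    then have "inner u f = 0 \<or> t\<^sup>2 = r\<^sup>2" by auto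
    then show ?thesis using r[of v] by auto
  qed
  then have w: "inner (T w) (T v) = t\<^sup>2 * inner w v" for v
    unfolding Tw unfolding w_def inner_sum_left inner_scaleR_left sum_distrib_left
    by (intro sum.cong refl)
  have wF: "w \<in> span F" unfolding w_def by (intro span_sum span_scale span_base)
  then have ne: "u - w \<noteq> 0" using u F(4) by auto
  define e where "e = (u - w) /\<^sub>R norm (u - w)"
  have e1: "norm e = 1" using ne by (simp add: e_def)
  have eF: "inner e f = 0" if "f \<in> F" for f
    using orthonormal_inner[OF F(3,1) that, of "inner u"]
    by (simp add: e_def w_def inner_diff_left)
  have "e \<notin> F" using eF[of e] e1 by auto
  have Te: "inner (T e) (T v) = t\<^sup>2 * inner e v" for v
    using t(2)[of v] w[of v]
    by (simp add: e_def linear_scale[OF assms(1)] linear_diff[OF assms(1)] inner_diff_left algebra_simps)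
  have u_eq: "u = norm (u - w) *\<^sub>R e + w" using ne by (simp add: e_def)
  have "span (insert e F) = span (insert u U)"
  proof (rule antisym; rule span_minimal[OF _ subspace_span]; rule insert_subsetI)
    have "w \<in> span (insert u U)" using wF F(4) span_mono[of U "insert u U"] by auto
    then show "e \<in> span (insert u U)"
      unfolding e_def by (intro span_scale span_diff) (auto simp: span_base)
    show "F \<subseteq> span (insert u U)"
      using F(4) span_superset[of F] span_mono[of U "insert u U"] by auto
    have "w \<in> span (insert e F)" using wF span_mono[of F "insert e F"] by auto
    then show "u \<in> span (insert e F)"
      by (subst u_eq) (intro span_add span_scale, auto simp: span_base)
    show "U \<subseteq> span (insert e F)"
      using F(4) span_superset[of U] span_mono[of F "insert e F"] by auto
  qed
  moreover have "orthonormal (insert e F)"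
    using F(3) eF e1 by (auto simp: orthonormal_def pairwise_insert inner_commute)
  ultimately show ?case
    using F \<open>e \<notin> F\<close> insert.hyps eig t(1) Te
    by (intro exI[of _ "insert e F"]) auto
qed

lemma inner_sum_orthonormal:
  fixes E :: "'a::real_inner set"
  assumes "finite E" "orthonormal E"
  shows "inner (\<Sum>e\<in>E. a e *\<^sub>R e) (\<Sum>e\<in>E. b e *\<^sub>R e) = (\<Sum>e\<in>E. a e * b e)"
  using orthonormal_inner[OF assms(2,1), of _ a]
  by (subst inner_sum_right) (auto intro!: sum.cong)

lemma bessel_inequality:
  fixes E :: "'a::real_inner set"
  assumes "finite E" "orthonormal E"
  shows "(\<Sum>e\<in>E. (inner x e)\<^sup>2) \<le> (norm x)\<^sup>2"
proof -
  define p where "p = (\<Sum>e\<in>E. inner x e *\<^sub>R e)"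
  have "inner p p = (\<Sum>e\<in>E. (inner x e)\<^sup>2)"
    unfolding p_def inner_sum_orthonormal[OF assms] by (simp add: power2_eq_square)
  moreover have "inner x p = (\<Sum>e\<in>E. (inner x e)\<^sup>2)"
    unfolding p_def by (simp add: inner_sum_right power2_eq_square)
  moreover have "0 \<le> inner (x - p) (x - p)" by simp
  ultimately show ?thesis
    by (simp add: inner_diff inner_commute power2_norm_eq_inner)
qed

text \<open>An orthogonal spanning set may contain 0, which has to be dropped before normalising.
  \<open>B\<close> may be dependent, hence only an inequality between the cardinalities.\<close>

lemma orthonormal_basis_of_finite:
  fixes B :: "'a::real_inner set"
  assumes "finite B"
  shows "\<exists>E. finite E \<and> card E \<le> card B \<and> orthonormal E \<and> span E = span B"
proof -
  obtain C where C: "finite C" "card C \<le> card B" "span C = span B" "pairwise orthogonal C"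
    using basis_orthogonal[OF assms] by blast
  have inj: "inj_on (\<lambda>x. x /\<^sub>R norm x) (C - {0})"
  proof (rule inj_onI, rule ccontr)
    fix x y assume x: "x \<in> C - {0}" and y: "y \<in> C - {0}" and eq: "x /\<^sub>R norm x = y /\<^sub>R norm y"
      and "x \<noteq> y"
    then have "inner x y = 0" using C(4) by (auto simp: pairwise_def orthogonal_def)
    then have "inner (x /\<^sub>R norm x) (y /\<^sub>R norm y) = 0" by simp
    then have "inner (x /\<^sub>R norm x) (x /\<^sub>R norm x) = 0" using eq by simp
    then show False using x by simp
  qed
  define E where "E = (\<lambda>x. x /\<^sub>R norm x) ` (C - {0})"
  have "card E \<le> card C"
    unfolding E_def using C(1) by (meson card_image_le card_mono Diff_subset finite_Diff order_trans)
  moreover have "orthonormal E"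
    using C(4) by (auto simp: E_def orthonormal_def pairwise_def orthogonal_def)
  moreover have "span E = span C"
  proof (rule antisym; rule span_minimal[OF _ subspace_span])
    show "E \<subseteq> span C" by (auto simp: E_def intro: span_scale span_base)
    show "C \<subseteq> span E"
    proof
      fix x assume x: "x \<in> C"
      show "x \<in> span E"
      proof (cases "x = 0")
        case False
        then have "x /\<^sub>R norm x \<in> span E" using x by (auto simp: E_def intro: span_base)
        from span_scale[OF this, of "norm x"] show ?thesis using False by simp
      qed (simp add: span_zero)
    qed
  qed
  ultimately show ?thesis using C unfolding E_def by (intro exI[of _ E]) (auto simp: E_def)
qed

lemma ell2_norm_sums: "(\<lambda>k. (ell2_nth x k)\<^sup>2) sums (norm x)\<^sup>2"
proof -
  have "summable (\<lambda>k. (ell2_nth x k)\<^sup>2)" using ell2_nth[of x] by simp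
  moreover have "(norm x)\<^sup>2 = (\<Sum>k. (ell2_nth x k)\<^sup>2)"
    unfolding power2_norm_eq_inner inner_ell2.rep_eq by (simp add: power2_eq_square)
  ultimately show ?thesis by (simp add: summable_sums)
qed

text \<open>For \<open>r = f - P f\<close>, with \<open>P\<close> the projection onto the span of \<open>E\<close>, the eigenvector equation
  gives \<open>\<langle>T r, T f\<rangle> = t\<^sup>2 \<parallel>r\<parallel>\<^sup>2\<close> and \<open>\<parallel>T f\<parallel> = t\<close>, so \<open>s \<parallel>r\<parallel>\<^sup>2 \<le> \<parallel>T r\<parallel>\<close>; then sum over \<open>f\<close>.\<close>

lemma singular_vector_count_bound:
  fixes T :: "'a::real_inner \<Rightarrow> ell2"
  assumes coord: "\<And>x k. ell2_nth (T x) k = inner x (\<phi> k)"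
    and s: "0 < s"
    and F: "finite F" "orthonormal F"
      "\<And>f. f \<in> F \<Longrightarrow> \<exists>t\<ge>s. \<forall>v. inner (T f) (T v) = t\<^sup>2 * inner f v"
    and E: "finite E" "orthonormal E" "card E \<le> card F"
    and \<psi>: "\<And>k. \<phi> k - \<psi> k \<in> span E"
    and H: "\<And>N. (\<Sum>k<N. (norm (\<psi> k))\<^sup>2) \<le> H"
  shows "(s * (real (card F) - real (card E)))\<^sup>2 \<le> real (card F) * H"
proof -
  define P where "P x = (\<Sum>e\<in>E. inner x e *\<^sub>R e)" for x
  have P_sym: "inner (P x) y = inner x (P y)" for x y
    by (simp add: P_def inner_sum_left inner_sum_right inner_commute mult.commute)
  have P_fix: "P v = v" if "v \<in> span E" for v
    using orthonormal_expansion[OF E(2,1) that] by (simp add: P_def)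
  have P_span: "P x \<in> span E" for x
    unfolding P_def by (intro span_sum span_scale span_base)
  define r where "r x = x - P x" for x
  have r_sym: "inner (r x) y = inner x (r y)" for x y
    by (simp add: r_def inner_diff P_sym)
  have r_span: "r v = 0" if "v \<in> span E" for v
    using P_fix[OF that] by (simp add: r_def)
  have rr: "r (r x) = r x" for x
    using P_fix[OF P_span, of x] unfolding r_def P_def
    by (simp add: inner_diff_left scaleR_diff_left sum_subtractf)
  have r_norm: "(norm (r x))\<^sup>2 = inner x (r x)" for x
    by (simp add: power2_norm_eq_inner r_sym rr)
  have r_sq: "(norm (r x))\<^sup>2 = (norm x)\<^sup>2 - (\<Sum>e\<in>E. (inner x e)\<^sup>2)" for x
    unfolding r_norm
    by (simp add: r_def P_def inner_diff_right inner_sum_right power2_eq_square power2_norm_eq_inner)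
       (simp add: power2_norm_eq_inner[symmetric] power2_eq_square)
  have r_le: "(norm (r x))\<^sup>2 \<le> (norm x)\<^sup>2" for x
    unfolding r_sq by (simp add: sum_nonneg)
  \<comment> \<open>The self-adjoint projection \<open>r\<close> kills \<open>span E\<close>, so
    \<open>T \<circ> r\<close> sees only the remainders \<open>\<psi> k\<close>. This is how their
    total mass \<open>H\<close> bounds it.\<close>
  have coord_r: "ell2_nth (T (r f)) k = inner f (r (\<psi> k))" for f k
  proof -
    have "inner (r f) (\<phi> k - \<psi> k) = 0" unfolding r_sym using r_span[OF \<psi>] by simp
    then show ?thesis unfolding coord r_sym[symmetric] by (simp add: inner_diff_right)
  qed
  have 1: "s * (norm (r f))\<^sup>2 \<le> norm (T (r f))" if f: "f \<in> F" for f
  proof -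
    obtain t where t: "t \<ge> s" and eq: "\<And>v. inner (T f) (T v) = t\<^sup>2 * inner f v"
      using F(3)[OF f] by blast
    have "inner f f = 1"
      using F(2) f by (simp add: orthonormal_def power2_norm_eq_inner[symmetric])
    then have "(norm (T f))\<^sup>2 = t\<^sup>2" using eq[of f] by (simp add: power2_norm_eq_inner)
    then have nT: "norm (T f) = t" using t s by (simp add: power2_eq_iff_nonneg)
    have "t\<^sup>2 * (norm (r f))\<^sup>2 \<le> norm (T f) * norm (T (r f))"
      using eq[of "r f"] norm_cauchy_schwarz[of "T f" "T (r f)"] by (simp add: r_norm)
    then have "t * (t * (norm (r f))\<^sup>2) \<le> t * norm (T (r f))"
      unfolding nT by (simp add: power2_eq_square)
    then have "t * (norm (r f))\<^sup>2 \<le> norm (T (r f))" using t s by simp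
    moreover have "s * (norm (r f))\<^sup>2 \<le> t * (norm (r f))\<^sup>2" using t by (intro mult_right_mono) auto
    ultimately show ?thesis by simp
  qed
  \<comment> \<open>Sum over coordinates outside and over \<open>F\<close> inside; for each fixed
    \<open>k\<close>, Bessel's inequality for \<open>F\<close> applies to
    \<open>r (\<psi> k)\<close>.\<close>
  have 2: "(\<Sum>f\<in>F. (norm (T (r f)))\<^sup>2) \<le> H"
  proof -
    have sums: "(\<lambda>k. \<Sum>f\<in>F. (inner f (r (\<psi> k)))\<^sup>2) sums (\<Sum>f\<in>F. (norm (T (r f)))\<^sup>2)"
      unfolding coord_r[symmetric] by (intro sums_sum ell2_norm_sums)
    have "(\<Sum>k<N. \<Sum>f\<in>F. (inner f (r (\<psi> k)))\<^sup>2) \<le> H" for N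
    proof -
      have "(\<Sum>k<N. \<Sum>f\<in>F. (inner f (r (\<psi> k)))\<^sup>2) \<le> (\<Sum>k<N. (norm (\<psi> k))\<^sup>2)"
      proof (rule sum_mono)
        fix k
        have "(\<Sum>f\<in>F. (inner f (r (\<psi> k)))\<^sup>2) \<le> (norm (r (\<psi> k)))\<^sup>2"
          using bessel_inequality[OF F(1,2), of "r (\<psi> k)"] by (simp add: inner_commute)
        also have "\<dots> \<le> (norm (\<psi> k))\<^sup>2" by (rule r_le)
        finally show "(\<Sum>f\<in>F. (inner f (r (\<psi> k)))\<^sup>2) \<le> (norm (\<psi> k))\<^sup>2" .
      qed
      then show ?thesis using H[of N] by linarith
    qed
    then show ?thesis using suminf_le_const[of _ H] sums by (metis sums_iff)
  qed
  \<comment> \<open>A trace count: by Bessel with the roles of \<open>E\<close> and \<open>F\<close>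
    exchanged, \<open>F\<close> has at most \<open>card E\<close> of its total squared length inside
    \<open>span E\<close>.\<close>
  have 3: "real (card F) - real (card E) \<le> (\<Sum>f\<in>F. (norm (r f))\<^sup>2)"
  proof -
    have "(\<Sum>f\<in>F. \<Sum>e\<in>E. (inner f e)\<^sup>2) = (\<Sum>e\<in>E. \<Sum>f\<in>F. (inner e f)\<^sup>2)"
      by (subst sum.swap) (simp add: inner_commute)
    also have "\<dots> \<le> (\<Sum>e\<in>E. (norm e)\<^sup>2)"
      by (intro sum_mono bessel_inequality F)
    also have "\<dots> = real (card E)" using E(2) by (simp add: orthonormal_def)
    finally have "(\<Sum>f\<in>F. \<Sum>e\<in>E. (inner f e)\<^sup>2) \<le> real (card E)" .
    moreover have "(\<Sum>f\<in>F. (norm f)\<^sup>2) = real (card F)"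
      using F(2) by (simp add: orthonormal_def)
    ultimately show ?thesis unfolding r_sq by (simp add: sum_subtractf)
  qed
  have "(s * (real (card F) - real (card E)))\<^sup>2 \<le> (s * (\<Sum>f\<in>F. (norm (r f))\<^sup>2))\<^sup>2"
    using 3 s E(3) by (intro power_mono mult_left_mono) auto
  \<comment> \<open>The factor 1 prepares Cauchy-Schwarz, which produces
    \<open>card F\<close>.\<close>
  also have "\<dots> = (\<Sum>f\<in>F. 1 * (s * (norm (r f))\<^sup>2))\<^sup>2"
    by (simp add: sum_distrib_left)
  also have "\<dots> \<le> (\<Sum>f\<in>F. 1\<^sup>2) * (\<Sum>f\<in>F. (s * (norm (r f))\<^sup>2)\<^sup>2)"
    by (rule Cauchy_Schwarz_ineq_sum)
  also have "\<dots> \<le> real (card F) * (\<Sum>f\<in>F. (norm (T (r f)))\<^sup>2)"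
    using 1 s by (intro mult_mono sum_mono power_mono) (auto simp: sum_nonneg)
  also have "\<dots> \<le> real (card F) * H" using 2 by (intro mult_left_mono) auto
  finally show ?thesis .
qed

section \<open>Two-sided estimates for singular values of operators with an adjoint\<close>

lemma linear_of_adjoint:
  fixes T :: "'a::real_inner \<Rightarrow> 'b::real_inner"
  assumes "\<And>x y. inner (T x) y = inner x (S y)"
  shows "linear T"
proof (rule linearI)
  show "T (x + y) = T x + T y" for x y
    using assms by (subst vector_eq_rdot[symmetric]) (simp add: inner_add_left)
  show "T (c *\<^sub>R x) = c *\<^sub>R T x" for c x
    using assms by (subst vector_eq_rdot[symmetric]) simp
qed

text \<open>\<open>adjoint\<close> is defined by choice and obeys its equation only if some adjoint
  exists. The pointwise representers form one, and \<open>adjoint_unique\<close> identifies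
  it.\<close>

lemma adjoint_inner:
  fixes T :: "'a::real_inner \<Rightarrow> 'b::real_inner"
  assumes "\<And>y. \<exists>z. \<forall>x. inner (T x) y = inner x z"
  shows "inner (T x) y = inner x (adjoint T y)"
proof -
  obtain S where S: "\<forall>x y. inner (T x) y = inner x (S y)" using assms by metis
  then show ?thesis using adjoint_unique[OF S] by simp
qed

lemma singular_space_inner:
  fixes T :: "'a::real_inner \<Rightarrow> 'b::real_inner"
  assumes "\<And>x y. inner (T x) y = inner x (adjoint T y)" "u \<in> singular_space T s"
  shows "inner (T u) (T v) = s\<^sup>2 * inner u v"
proof -
  have "inner (T u) (T v) = inner v (adjoint T (T u))" using assms(1) by (simp add: inner_commute)
  then show ?thesis using assms(2) by (simp add: singular_space_def inner_commute)
qed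

text \<open>Every \<open>s\<close> competing in the supremum comes with \<open>i\<close> independent
  singular vectors; once these are orthonormal, \<open>singular_vector_count_bound\<close> limits
  \<open>s\<close>. The condition on \<open>b\<close> is kept squared to avoid a root of
  \<open>H\<close>.\<close>

lemma singular_value_upper_bound:
  fixes T :: "'a::real_inner \<Rightarrow> ell2"
  assumes adj: "\<And>x y. inner (T x) y = inner x (adjoint T y)"
    and coord: "\<And>x k. ell2_nth (T x) k = inner x (\<phi> k)"
    and B: "finite B" "card B < i" "\<And>k. \<phi> k - \<psi> k \<in> span B"
    and H: "\<And>N. (\<Sum>k<N. (norm (\<psi> k))\<^sup>2) \<le> H"
    and b: "0 \<le> b" "real i * H \<le> (b * (real i - real (card B)))\<^sup>2"
  shows "singular_value T i \<le> b"
  unfolding singular_value_def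
proof (rule cSup_least)
  fix s assume "s \<in> insert 0 {s. 0 < s \<and>
      (\<exists>U. finite U \<and> card U = i \<and> independent U \<and> U \<subseteq> (\<Union>t\<in>{s..}. singular_space T t))}"
  then consider "s = 0" | U where "0 < s" "finite U" "card U = i" "independent U"
      "U \<subseteq> (\<Union>t\<in>{s..}. singular_space T t)" by auto
  then show "s \<le> b"
  proof cases
    case 2
    have "\<exists>t\<ge>s. \<forall>v. inner (T u) (T v) = t\<^sup>2 * inner u v" if "u \<in> U" for u
    proof -
      have "\<exists>t\<ge>s. u \<in> singular_space T t" using 2(5) that by auto
      then obtain t where "t \<ge> s" "u \<in> singular_space T t" by blast
      then show ?thesis using singular_space_inner[OF adj] by blast
    qed
    then obtain F where F: "finite F" "card F = i" "orthonormal F"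
      and eig: "\<forall>f\<in>F. \<exists>t\<ge>s. \<forall>v. inner (T f) (T v) = t\<^sup>2 * inner f v"
      using orthonormal_eigenvectors[OF linear_of_adjoint[OF adj] 2(2,4), of s] 2(3) by blast
    obtain E where E: "finite E" "card E \<le> card B" "orthonormal E" "span E = span B"
      using orthonormal_basis_of_finite[OF B(1)] by blast
    have "(s * (real i - real (card E)))\<^sup>2 \<le> real i * H"
      using singular_vector_count_bound[OF coord 2(1) F(1,3) _ E(1,3) _ _ H] eig F(2) E B by simp
    also note b(2)
    \<comment> \<open>Orthonormalising \<open>B\<close> can only lower the dimension, which enlarges
      the factor on the right.\<close>
    also have "(b * (real i - real (card B)))\<^sup>2 \<le> (b * (real i - real (card E)))\<^sup>2"
      using b(1) B(2) E(2) by (intro power_mono mult_left_mono) auto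
    finally have "s * (real i - real (card E)) \<le> b * (real i - real (card E))"
    proof (rule power2_le_imp_le)
      show "0 \<le> b * (real i - real (card E))" using b(1) E(2) B(2) by simp
    qed
    then show ?thesis using E(2) B(2) by simp
  qed (use b in simp)
qed simp

text \<open>The set \<open>U\<close> makes \<open>s\<close> a member of the set under the supremum.
  The norm bound makes that set bounded above: for \<open>i >= 1\<close> each member
  \<open>r\<close> has a nonzero singular vector whose singular value is at least \<open>r\<close>
  and at most \<open>b\<close>.\<close>

lemma singular_value_lower_bound:
  fixes T :: "'a::real_inner \<Rightarrow> 'b::real_inner"
  assumes adj: "\<And>x y. inner (T x) y = inner x (adjoint T y)"
    and bnd: "\<And>x. norm (T x) \<le> b * norm x" "0 \<le> b"
    and s: "0 < s" "1 \<le> i"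
    and U: "finite U" "card U = i" "independent U" "U \<subseteq> (\<Union>t\<in>{s..}. singular_space T t)"
  shows "s \<le> singular_value T i"
  unfolding singular_value_def
proof (rule cSup_upper)
  show "bdd_above (insert 0 {s. 0 < s \<and>
      (\<exists>U. finite U \<and> card U = i \<and> independent U \<and> U \<subseteq> (\<Union>t\<in>{s..}. singular_space T t))})"
  proof (rule bdd_aboveI)
    fix r assume "r \<in> insert 0 {s. 0 < s \<and>
      (\<exists>U. finite U \<and> card U = i \<and> independent U \<and> U \<subseteq> (\<Union>t\<in>{s..}. singular_space T t))}"
    then consider "r = 0" | U where "0 < r" "card U = i" "independent U"
      "U \<subseteq> (\<Union>t\<in>{r..}. singular_space T t)" by auto
    then show "r \<le> b"
    proof cases
      case 2
      then obtain u where "u \<in> U" using s(2) by fastforce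
      then obtain t where t: "t \<ge> r" "u \<in> singular_space T t" using 2(4) by auto
      have u: "u \<noteq> 0" using \<open>u \<in> U\<close> 2(3) dependent_zero by blast
      have "(norm (T u))\<^sup>2 = (t * norm u)\<^sup>2"
        using singular_space_inner[OF adj t(2), of u]
        by (simp add: power2_norm_eq_inner power_mult_distrib)
      then have "norm (T u) = t * norm u" using t(1) 2(1) by (simp add: power2_eq_iff_nonneg)
      then have "t \<le> b" using bnd(1)[of u] u by simp
      then show ?thesis using t by simp
    qed (use bnd in simp)
  qed
qed (use s U in blast)

section \<open>The integration operator\<close>

lemma set_integral_FTC:
  fixes F f :: "real \<Rightarrow> real"
  assumes "a \<le> b" "\<And>t. (F has_real_derivative f t) (at t)" "continuous_on {a..b} f"
  shows "(LBINT t:{a<..<b}. f t) = F b - F a"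
proof -
  have "(LBINT t=ereal a..ereal b. f t) = F b - F a"
    using assms
    by (intro interval_integral_FTC_finite)
       (auto simp: has_real_derivative_iff_has_vector_derivative min_def max_def
          intro: has_vector_derivative_at_within)
  then show ?thesis using assms(1) by (simp add: interval_lebesgue_integral_def)
qed

lemma unit_integral_eq: "(LINT t|unit_measure. f t) = (LBINT t:{0<..<1}. f t)" for f :: "real \<Rightarrow> real"
  by (simp add: integral_restrict_space set_lebesgue_integral_def)

lemma inner_L2_unit_abs:
  assumes "square_integrable f" "square_integrable g"
  shows "inner (abs_L2_unit f) (abs_L2_unit g) = (LINT t|unit_measure. f t * g t)"
  using assms by (intro inner_L2_unit.abs_eq) auto

lemma L2_unit_cases:
  obtains f where "square_integrable f" "x = abs_L2_unit f"
proof -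
  have "\<exists>f. square_integrable f \<and> x = abs_L2_unit f"
    by (rule L2_unit.abs_induct) blast
  then show ?thesis using that by blast
qed

lemma abs_L2_unit_eqI:
  assumes "square_integrable f" "square_integrable g" "\<And>t. 0 < t \<Longrightarrow> t < 1 \<Longrightarrow> f t = g t"
  shows "abs_L2_unit f = abs_L2_unit g"
proof -
  have "AE t in unit_measure. f t = g t"
    using assms(3) by (intro AE_I2) (simp add: space_restrict_space)
  then show ?thesis using assms(1,2) Quotient3_rel[OF Quotient3_L2_unit, of f g] by simp
qed

lemma scaleR_L2_unit_abs:
  assumes "square_integrable f"
  shows "c *\<^sub>R abs_L2_unit f = abs_L2_unit (\<lambda>t. c * f t)"
  using assms by (intro scaleR_L2_unit.abs_eq) auto

lemma integration_op_abs:
  assumes "square_integrable f"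
  shows "integration_op (abs_L2_unit f) = abs_L2_unit (\<lambda>s. LBINT t:{0<..<s}. f t)"
  using assms by (intro integration_op.abs_eq) auto

definition monom_L2 :: "nat \<Rightarrow> L2_unit"
  where "monom_L2 j = abs_L2_unit (\<lambda>t. t ^ j)"

lemma hausdorff_op_nth: "ell2_nth (hausdorff_op z) j = inner z (monom_L2 j)"
proof (cases z rule: L2_unit_cases)
  case (1 f)
  then have "ell2_nth (hausdorff_op z) j = (LINT t|unit_measure. t ^ j * f t)"
    by (subst 1(2)) (subst hausdorff_op.abs_eq, auto simp: Abs_ell2_inverse summable_moments)
  then show ?thesis
    using 1 by (simp add: monom_L2_def inner_L2_unit_abs square_integrable_power mult.commute)
qed

lemma inner_monom_L2: "inner (monom_L2 j) (monom_L2 k) = 1 / (real (j + k) + 1)"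
  by (simp add: monom_L2_def inner_L2_unit_abs square_integrable_power
      power_add[symmetric] integral_unit_power)

lemma integration_op_monom: "integration_op (monom_L2 k) = (1 / (real k + 1)) *\<^sub>R monom_L2 (Suc k)"
proof -
  have "(LBINT t:{0<..<s}. t ^ k) = (1 / (real k + 1)) * s ^ Suc k" if "0 < s" for s :: real
    using that
    by (subst set_integral_FTC[where F = "\<lambda>t. (1 / (real k + 1)) * t ^ Suc k"])
       (auto intro!: derivative_eq_intros continuous_intros simp del: power_Suc simp: add.commute)
  then show ?thesis
    unfolding monom_L2_def integration_op_abs[OF square_integrable_power]
      scaleR_L2_unit_abs[OF square_integrable_power]
    by (intro abs_L2_unit_eqI square_integrable_primitive square_integrable_power
          square_integrable_scale) auto
qed

section \<open>The adjoint of the integration operator\<close>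

text \<open>Integration by parts via Fubini: both summands integrate F(t) G(s), one over the
  triangle t < s, the other over s < t. Together these fill the plane up to the diagonal, a null
  set.\<close>

lemma integral_triangles:
  fixes F G :: "real \<Rightarrow> real"
  assumes F: "integrable lborel F" and G: "integrable lborel G"
  shows "(LINT s|lborel. G s * (LINT t|lborel. indicator {..<s} t * F t))
       + (LINT t|lborel. F t * (LINT s|lborel. indicator {..<t} s * G s))
     = (LINT t|lborel. F t) * (LINT s|lborel. G s)"
proof -
  note [measurable] = borel_measurable_integrable[OF F] borel_measurable_integrable[OF G]
  have prod: "integrable (lborel \<Otimes>\<^sub>M lborel) (\<lambda>(t, s). F t * G s)"
    by (rule lborel_pair.Fubini_integrable) (use F G in \<open>auto simp: abs_mult\<close>)
  let ?f = "\<lambda>t s. if t < s then F t * G s else 0"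
  have tri: "integrable (lborel \<Otimes>\<^sub>M lborel) (case_prod ?f)"
    by (rule Bochner_Integration.integrable_bound[OF prod]) auto
  have half: "(LINT s|lborel. indicator {..<t} s * G s) 
      = (LINT s|lborel. G s) - (LINT s|lborel. indicator {t<..} s * G s)" for t
  proof -
    have "(LINT s|lborel. G s) = (LINT s|lborel. indicator {..<t} s * G s + indicator {t<..} s * G s)"
    proof (rule integral_cong_AE)
      show "AE s in lborel. G s = indicator {..<t} s * G s + indicator {t<..} s * G s"
        using AE_lborel_singleton[of t] by eventually_elim (auto simp: indicator_def)
    qed auto
    also have "\<dots> = (LINT s|lborel. indicator {..<t} s * G s) + (LINT s|lborel. indicator {t<..} s * G s)"
      using integrable_mult_indicator[OF _ G, of "{..<t}"] integrable_mult_indicator[OF _ G, of "{t<..}"]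
      by (intro Bochner_Integration.integral_add) auto
    finally show ?thesis by simp
  qed
  have "(LINT s|lborel. G s * (LINT t|lborel. indicator {..<s} t * F t))
      = (LINT s|lborel. LINT t|lborel. ?f t s)"
    unfolding integral_mult_right_zero[symmetric]
    by (intro Bochner_Integration.integral_cong) (auto simp: indicator_def)
  also have "\<dots> = (LINT t|lborel. LINT s|lborel. ?f t s)"
    by (rule lborel_pair.Fubini_integral[OF tri])
  also have "\<dots> = (LINT t|lborel. F t * (LINT s|lborel. indicator {t<..} s * G s))"
    unfolding integral_mult_right_zero[symmetric]
    by (intro Bochner_Integration.integral_cong) (auto simp: indicator_def)
  finally have 1: "(LINT s|lborel. G s * (LINT t|lborel. indicator {..<s} t * F t))
     = (LINT t|lborel. F t * (LINT s|lborel. indicator {t<..} s * G s))" .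
  \<comment> \<open>Integrability of this inner integral is needed to split the integral of the
    difference coming from \<open>half\<close>.\<close>
  have "integrable lborel (\<lambda>t. LINT s|lborel. ?f t s)"
    using lborel_pair.integrable_fst[OF tri] by simp
  also have "(\<lambda>t. LINT s|lborel. ?f t s) = (\<lambda>t. F t * (LINT s|lborel. indicator {t<..} s * G s))"
    unfolding integral_mult_right_zero[symmetric]
    by (intro ext Bochner_Integration.integral_cong) (auto simp: indicator_def)
  finally have int: "integrable lborel (\<lambda>t. F t * (LINT s|lborel. indicator {t<..} s * G s))" .
  show ?thesis
    unfolding 1 half right_diff_distrib using F int by simp
qed

text \<open>\<open>J + J\<^sup>*\<close> has rank one, which makes \<open>J\<^sup>*\<close> explicit in terms of \<open>J\<close>.\<close>

lemma inner_integration_op_add: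
  "inner (integration_op x) y + inner x (integration_op y) = inner x (monom_L2 0) * inner y (monom_L2 0)"
proof (cases x rule: L2_unit_cases)
  case x: (1 f)
  show ?thesis
  proof (cases y rule: L2_unit_cases)
    case y: (1 g)
    let ?F = "\<lambda>t. indicator {0<..<1} t * f t" and ?G = "\<lambda>t. indicator {0<..<1} t * g t"
    \<comment> \<open>Cutting the functions off outside (0,1) turns the interval (0,s) into a
      half-line, the form used in \<open>integral_triangles\<close>.\<close>
    have eq: "(LINT s|unit_measure. (LBINT t:{0<..<s}. u t) * v s)
      = (LINT s|lborel. (indicator {0<..<1} s * v s)
          * (LINT t|lborel. indicator {..<s} t * (indicator {0<..<1} t * u t)))"
      for u v :: "real \<Rightarrow> real"
      unfolding unit_integral_eq set_lebesgue_integral_def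
    proof (rule Bochner_Integration.integral_cong)
      fix s :: real
      have "(LINT t|lborel. indicator {0<..<s} t *\<^sub>R u t)
          = (LINT t|lborel. indicator {..<s} t * (indicator {0<..<1} t * u t))"
        if "s \<in> {0<..<1}"
        by (intro Bochner_Integration.integral_cong) (use that in \<open>auto simp: indicator_def\<close>)
      then show "indicator {0<..<1} s *\<^sub>R ((LINT t|lborel. indicator {0<..<s} t *\<^sub>R u t) * v s)
        = indicator {0<..<1} s * v s * (LINT t|lborel. indicator {..<s} t * (indicator {0<..<1} t * u t))"
        by (cases "s \<in> {0<..<1}") auto
    qed simp
    have one: "inner (abs_L2_unit u) (monom_L2 0) = (LINT t|lborel. indicator {0<..<1} t * u t)"
      if "square_integrable u" for u
      using that square_integrable_power[of 0]
      by (simp add: monom_L2_def inner_L2_unit_abs unit_integral_eq set_lebesgue_integral_def)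
    have "inner (integration_op x) y = (LINT s|unit_measure. (LBINT t:{0<..<s}. f t) * g s)"
      using x y by (simp add: integration_op_abs inner_L2_unit_abs square_integrable_primitive)
    moreover have "inner x (integration_op y) = (LINT s|unit_measure. (LBINT t:{0<..<s}. g t) * f s)"
      using x y by (simp add: integration_op_abs inner_L2_unit_abs square_integrable_primitive mult.commute)
    ultimately show ?thesis
      using integral_triangles[OF square_integrable_lborel[OF x(1)] square_integrable_lborel[OF y(1)]]
      by (simp only: eq x y one)
  qed
qed

lemma inner_integration_op:
  "inner (integration_op x) y = inner x (inner y (monom_L2 0) *\<^sub>R monom_L2 0 - integration_op y)"
  unfolding inner_diff_right inner_scaleR_right
  using inner_integration_op_add[of x y] by (simp only: eq_diff_eq mult.commute)

lemma integration_op_adjoint: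
  "adjoint integration_op = (\<lambda>y. inner y (monom_L2 0) *\<^sub>R monom_L2 0 - integration_op y)"
  by (rule adjoint_unique) (intro allI inner_integration_op)

text \<open>Each value of the primitive is an inner product with the indicator of (0,s), of norm at
  most 1; then integrate its square over a space of measure 1. This supplies the norm bound in
  \<open>singular_value_lower_bound\<close>.\<close>

lemma norm_integration_op_le: "norm (integration_op x) \<le> norm x"
proof (cases x rule: L2_unit_cases)
  case (1 f)
  have ind: "square_integrable (indicator {0<..<s})" for s :: real
    by (rule square_integrable_bounded[where B = 1]) (auto simp: indicator_def intro!: measurable_restrict_space1)
  have prob: "measure unit_measure (space unit_measure) = 1"
    by (simp add: measure_restrict_space space_restrict_space)
  interpret finite_measure unit_measure by (rule finite_measure_unit)
  define p where "p s = (LBINT t:{0<..<s}. f t)" for s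
  have p: "square_integrable p" unfolding p_def by (rule square_integrable_primitive[OF 1(1)])
  have "(p s)\<^sup>2 \<le> (norm x)\<^sup>2" if s: "s \<in> {0<..<1}" for s
  proof -
    have "norm (abs_L2_unit (indicator {0<..<s})) \<le> 1"
    proof -
      have "(LINT t|unit_measure. indicator {0<..<s} t * indicator {0<..<s} t) \<le> (LINT t|unit_measure. (1::real))"
        using square_integrable_mult[OF ind ind] by (intro integral_mono) (auto simp: indicator_def)
      then have "(LINT t|unit_measure. indicator {0<..<s} t * indicator {0<..<s} t) \<le> (1::real)"
        using prob by (simp only: lebesgue_integral_const) simp
      then show ?thesis
        by (simp add: norm_eq_sqrt_inner inner_L2_unit_abs[OF ind ind])
    qed
    moreover have "p s = inner x (abs_L2_unit (indicator {0<..<s}))"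
      unfolding p_def 1(2) inner_L2_unit_abs[OF 1(1) ind] unit_integral_eq set_lebesgue_integral_def
      by (rule Bochner_Integration.integral_cong) (use s in \<open>auto simp: indicator_def\<close>)
    ultimately have "\<bar>p s\<bar> \<le> norm x * 1"
      using Cauchy_Schwarz_ineq2[of x "abs_L2_unit (indicator {0<..<s})"]
      by (metis mult_left_mono norm_ge_zero order_trans)
    then show ?thesis by (simp add: abs_le_square_iff[symmetric])
  qed
  then have "(LINT s|unit_measure. (p s)\<^sup>2) \<le> (LINT s|unit_measure. (norm x)\<^sup>2)"
    using p by (intro integral_mono) (auto simp: square_integrable_def space_restrict_space)
  moreover have "(norm (integration_op x))\<^sup>2 = (LINT s|unit_measure. (p s)\<^sup>2)"
    unfolding power2_norm_eq_inner 1(2) integration_op_abs[OF 1(1)] p_def[symmetric]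
      inner_L2_unit_abs[OF p p] by (simp add: power2_eq_square)
  ultimately have "(norm (integration_op x))\<^sup>2 \<le> (norm x)\<^sup>2"
    using prob by (simp only: lebesgue_integral_const) simp
  then show ?thesis by (rule power2_le_imp_le) simp
qed

section \<open>Cosines as singular vectors of the integration operator\<close>

text \<open>These are the positive zeros of the cosine; vanishing at t = 1 is the boundary condition
  that lets the adjoint send sines back to cosines.\<close>

definition freq :: "nat \<Rightarrow> real"
  where "freq k = (real k + 1/2) * pi"

lemma freq_pos: "freq k > 0"
  by (simp add: freq_def)

lemma cos_freq: "cos (freq k) = 0"
  by (simp add: freq_def distrib_right cos_add)

definition cos_L2 :: "nat \<Rightarrow> L2_unit"
  where "cos_L2 k = abs_L2_unit (\<lambda>t. cos (freq k * t))"

definition sin_L2 :: "nat \<Rightarrow> L2_unit"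
  where "sin_L2 k = abs_L2_unit (\<lambda>t. sin (freq k * t))"

lemma square_integrable_trig:
  "square_integrable (\<lambda>t. cos (a * t))" "square_integrable (\<lambda>t. sin (a * t))"
  by (rule square_integrable_bounded[where B = 1]; auto intro!: measurable_restrict_space1)+

lemma integration_op_cos: "integration_op (cos_L2 k) = (1 / freq k) *\<^sub>R sin_L2 k"
proof -
  have "(LBINT t:{0<..<s}. cos (freq k * t)) = (1 / freq k) * sin (freq k * s)" if "0 < s" for s :: real
    using that freq_pos[of k]
    by (subst set_integral_FTC[where F = "\<lambda>t. (1 / freq k) * sin (freq k * t)"])
       (auto intro!: derivative_eq_intros continuous_intros)
  then show ?thesis
    unfolding cos_L2_def sin_L2_def integration_op_abs[OF square_integrable_trig(1)]
      scaleR_L2_unit_abs[OF square_integrable_trig(2)]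
    by (intro abs_L2_unit_eqI square_integrable_primitive square_integrable_trig
          square_integrable_scale) auto
qed

text \<open>By the formula for the adjoint, the constant \<open>1 / freq k\<close> in the primitive
  of the sine cancels against the mean of the sine, which has the same value because
  \<open>cos (freq k) = 0\<close>.\<close>

lemma adjoint_integration_op_sin: "adjoint integration_op (sin_L2 k) = (1 / freq k) *\<^sub>R cos_L2 k"
proof -
  have prim: "(LBINT t:{0<..<s}. sin (freq k * t)) = 1 / freq k - (1 / freq k) * cos (freq k * s)"
    if "0 < s" for s :: real
    using that freq_pos[of k]
    by (subst set_integral_FTC[where F = "\<lambda>t. - ((1 / freq k) * cos (freq k * t))"])
       (auto intro!: derivative_eq_intros continuous_intros)
  have "inner (sin_L2 k) (monom_L2 0) = 1 / freq k"
    using prim[of 1] inner_L2_unit_abs[OF square_integrable_trig(2) square_integrable_power[of 0], of "freq k"]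
    by (simp add: sin_L2_def monom_L2_def unit_integral_eq cos_freq)
  moreover have "integration_op (sin_L2 k) + (1 / freq k) *\<^sub>R cos_L2 k = (1 / freq k) *\<^sub>R monom_L2 0"
  proof -
    note sq = square_integrable_primitive[OF square_integrable_trig(2)]
      square_integrable_scale[OF square_integrable_trig(1)]
    have "integration_op (sin_L2 k) + (1 / freq k) *\<^sub>R cos_L2 k
      = abs_L2_unit (\<lambda>s. (LBINT t:{0<..<s}. sin (freq k * t)) + 1 / freq k * cos (freq k * s))"
      unfolding cos_L2_def sin_L2_def integration_op_abs[OF square_integrable_trig(2)]
        scaleR_L2_unit_abs[OF square_integrable_trig(1)]
      by (rule plus_L2_unit.abs_eq) (simp_all only: simp_thms eventually_True sq)
    also have "\<dots> = (1 / freq k) *\<^sub>R monom_L2 0"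
      unfolding monom_L2_def scaleR_L2_unit_abs[OF square_integrable_power]
      by (intro abs_L2_unit_eqI square_integrable_add sq square_integrable_scale square_integrable_power)
         (simp add: prim)
    finally show ?thesis .
  qed
  ultimately show ?thesis by (simp add: integration_op_adjoint algebra_simps)
qed

lemma adjoint_works_integration_op: "inner (integration_op x) y = inner x (adjoint integration_op y)"
  unfolding integration_op_adjoint by (rule inner_integration_op)

lemma adjoint_integration_op_scale: "adjoint integration_op (c *\<^sub>R y) = c *\<^sub>R adjoint integration_op y"
  by (subst vector_eq_ldot[symmetric]) (simp add: adjoint_works_integration_op[symmetric])

lemma cos_L2_singular: "cos_L2 k \<in> singular_space integration_op (1 / freq k)"
  by (simp add: singular_space_def integration_op_cos adjoint_integration_op_scale
      adjoint_integration_op_sin power2_eq_square)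

lemma cos_L2_nonzero: "cos_L2 k \<noteq> 0"
proof
  assume 0: "cos_L2 k = 0"
  \<comment> \<open>The oscillating part of the antiderivative vanishes at both ends, through the
    sine at 0 and the cosine at 1.\<close>
  have cc: "(LBINT t:{0<..<1}. cos (freq k * t) * cos (freq k * t)) = 1 / 2"
    using freq_pos[of k]
  proof (subst set_integral_FTC[where F = "\<lambda>t. t / 2 + sin (freq k * t) * cos (freq k * t) / (2 * freq k)"])
    fix t :: real
    have "1 - sin (freq k * t) * sin (freq k * t) = cos (freq k * t) * cos (freq k * t)"
      using sin_cos_squared_add[of "freq k * t"] by (simp add: power2_eq_square)
    \<comment> \<open>The identity sin^2 + cos^2 = 1 times 2 (freq k)^2, the shape left after
      clearing denominators in the derivative.\<close>
    then have "freq k * (freq k * 2) = freq k * (freq k * (2 * (cos (freq k * t) * cos (freq k * t))))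
        + freq k * (freq k * (2 * (sin (freq k * t) * sin (freq k * t))))"
      by (simp only: distrib_left[symmetric]) (simp add: algebra_simps)
    then show "((\<lambda>t. t / 2 + sin (freq k * t) * cos (freq k * t) / (2 * freq k)) has_real_derivative
        cos (freq k * t) * cos (freq k * t)) (at t)"
      using freq_pos[of k]
      by (auto intro!: derivative_eq_intros simp: field_simps)
  qed (auto intro!: continuous_intros simp: cos_freq)
  have "inner (cos_L2 k) (cos_L2 k) = 1 / 2"
    unfolding cos_L2_def inner_L2_unit_abs[OF square_integrable_trig(1) square_integrable_trig(1)]
      unit_integral_eq by (rule cc)
  then show False using 0 by simp
qed

text \<open>No integral is computed: singular vectors with different squared singular values are
  orthogonal.\<close>

lemma cos_L2_orthogonal:
  assumes "j \<noteq> k"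
  shows "inner (cos_L2 j) (cos_L2 k) = 0"
proof -
  have "(1 / freq j)\<^sup>2 * inner (cos_L2 j) (cos_L2 k) = (1 / freq k)\<^sup>2 * inner (cos_L2 j) (cos_L2 k)"
    using singular_space_inner[OF adjoint_works_integration_op cos_L2_singular, of j "cos_L2 k"]
      singular_space_inner[OF adjoint_works_integration_op cos_L2_singular, of k "cos_L2 j"]
    by (simp add: inner_commute)
  moreover have "(1 / freq j)\<^sup>2 \<noteq> (1 / freq k)\<^sup>2"
    using assms freq_pos[of j] freq_pos[of k]
    by (simp add: power2_eq_iff_nonneg) (simp add: freq_def)
  ultimately show ?thesis by simp
qed

text \<open>The first \<open>i\<close> cosines serve as witnesses, since
  \<open>freq k <= pi * i\<close> for \<open>k < i\<close>.\<close>

lemma singular_value_integration_op_ge: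
  assumes "1 \<le> i"
  shows "1 / (pi * real i) \<le> singular_value integration_op i"
proof (rule singular_value_lower_bound[OF adjoint_works_integration_op, where b = 1 and U = "cos_L2 ` {..<i}"])
  have inj: "inj_on cos_L2 {..<i}"
  proof (rule inj_onI, rule ccontr)
    fix j k assume "cos_L2 j = cos_L2 k" "j \<noteq> k"
    then have "inner (cos_L2 j) (cos_L2 j) = 0" using cos_L2_orthogonal[of j k] by simp
    then show False using cos_L2_nonzero by simp
  qed
  show "card (cos_L2 ` {..<i}) = i" by (simp add: card_image[OF inj])
  show "independent (cos_L2 ` {..<i})"
  proof (rule pairwise_orthogonal_independent)
    show "pairwise orthogonal (cos_L2 ` {..<i})"
    proof (rule pairwiseI)
      fix u v assume "u \<in> cos_L2 ` {..<i}" "v \<in> cos_L2 ` {..<i}" "u \<noteq> v"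
      then obtain j k where "u = cos_L2 j" "v = cos_L2 k" "j \<noteq> k" by blast
      then show "orthogonal u v" by (simp add: orthogonal_def cos_L2_orthogonal)
    qed
    show "0 \<notin> cos_L2 ` {..<i}" using cos_L2_nonzero by (metis imageE)
  qed
  show "cos_L2 ` {..<i} \<subseteq> (\<Union>t\<in>{1 / (pi * real i)..}. singular_space integration_op t)"
  proof (rule image_subsetI)
    fix k assume "k \<in> {..<i}"
    then have "freq k \<le> pi * real i" by (simp add: freq_def mult.commute)
    then have "1 / (pi * real i) \<le> 1 / freq k" using freq_pos[of k] by (intro divide_left_mono) auto
    then show "cos_L2 k \<in> (\<Union>t\<in>{1 / (pi * real i)..}. singular_space integration_op t)"
      using cos_L2_singular[of k] by auto
  qed
qed (use assms norm_integration_op_le in auto)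

section \<open>The Hausdorff moment operator after integration\<close>

definition moment_vec :: "nat \<Rightarrow> L2_unit"
  where "moment_vec k = (1 / (real k + 1)) *\<^sub>R (monom_L2 0 - monom_L2 (Suc k))"

lemma moment_vec_eq: "moment_vec k = adjoint integration_op (monom_L2 k)"
  unfolding moment_vec_def integration_op_adjoint integration_op_monom inner_monom_L2
  by (simp add: scaleR_diff_right)

lemma hausdorff_integration_nth:
  "ell2_nth ((hausdorff_op \<circ> integration_op) x) k = inner x (moment_vec k)"
  by (simp add: hausdorff_op_nth moment_vec_eq adjoint_works_integration_op)

lemma moment_vec_abs: "moment_vec k = abs_L2_unit (\<lambda>t. (1 / (real k + 1)) * (t ^ 0 - t ^ Suc k))"
proof -
  note sq = square_integrable_power[of 0] square_integrable_power[of "Suc k"]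
  have "monom_L2 0 - monom_L2 (Suc k) = abs_L2_unit (\<lambda>t. t ^ 0 - t ^ Suc k)"
    unfolding monom_L2_def
    by (rule minus_L2_unit.abs_eq) (simp_all only: simp_thms eventually_True sq)
  then show ?thesis
    unfolding moment_vec_def using scaleR_L2_unit_abs[OF square_integrable_diff[OF sq]] by simp
qed

lemma inverse_square_telescope: "(\<Sum>k<N. (1 / (real (m + k) + 2))\<^sup>2) \<le> 1 / (real m + 1)"
proof -
  have "(\<Sum>k<N. (1 / (real (m + k) + 2))\<^sup>2) \<le> (\<Sum>k<N. 1 / (real (m + k) + 1) - 1 / (real (m + Suc k) + 1))"
    \<comment> \<open>With x = m + k this is 1/(x+2)^2 <= 1/((x+1)(x+2)).\<close>
    by (intro sum_mono) (simp add: divide_simps power2_eq_square, simp add: algebra_simps)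
  also have "\<dots> = 1 / (real (m + 0) + 1) - 1 / (real (m + N) + 1)"
    by (rule sum_lessThan_telescope')
  also have "\<dots> \<le> 1 / (real m + 1)" by simp
  finally show ?thesis .
qed

lemma sum_inverse_squares_le: "(\<Sum>k<N. (1 / (real k + 1))\<^sup>2) \<le> 2"
proof (cases N)
  case (Suc M)
  have "(\<Sum>k<M. (1 / (real k + 2))\<^sup>2) \<le> 1" using inverse_square_telescope[where m = 0 and N = M] by simp
  then show ?thesis unfolding Suc sum.lessThan_Suc_shift by (simp add: add.commute)
qed simp

section \<open>Existence of the adjoint of the composition\<close>

text \<open>The representer is the series of the moment vectors with coefficients \<open>y\<close>.
  Square summability of \<open>y\<close> and |p_k| <= 1/(k+1) make it converge absolutely with a
  uniform bound, so its sum is square integrable.\<close>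

lemma hausdorff_integration_adjoint_exists:
  "\<exists>z. \<forall>x. inner ((hausdorff_op \<circ> integration_op) x) y = inner x z"
proof -
  define c where "c k = ell2_nth y k" for k
  \<comment> \<open>Writing \<open>t ^ 0\<close> for 1 matches the representative in
    \<open>moment_vec_abs\<close>.\<close>
  define p where "p k t = (1 / (real k + 1)) * (t ^ 0 - t ^ Suc k)" for k and t :: real
  have c2: "summable (\<lambda>k. (c k)\<^sup>2)" unfolding c_def using ell2_nth[of y] by simp
  have sc: "summable (\<lambda>k. \<bar>c k\<bar> * (1 / (real k + 1)))"
  proof (rule summable_mult_of_squares)
    show "summable (\<lambda>k. (1 / (real k + 1))\<^sup>2)"
      using sum_inverse_squares_le
      by (intro bounded_imp_summable[where B = 2]) (simp_all only: lessThan_Suc_atMost[symmetric] zero_le_power2)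
  qed (use c2 in simp)
  have p_bound: "\<bar>c k * p k t\<bar> \<le> \<bar>c k\<bar> * (1 / (real k + 1))" if "t \<in> {0<..<1}" for k t
  proof -
    have "0 \<le> t ^ Suc k" "t ^ Suc k \<le> 1" using that by (auto simp del: power_Suc intro!: power_le_one)
    then have "\<bar>p k t\<bar> \<le> (1 / (real k + 1)) * 1"
      unfolding p_def abs_mult by (intro mult_mono) (auto simp del: power_Suc)
    then show ?thesis unfolding abs_mult by (intro mult_left_mono) auto
  qed
  define g where "g t = (\<Sum>k. c k * p k t)" for t
  have summ: "summable (\<lambda>k. \<bar>c k * p k t\<bar>)" if "t \<in> {0<..<1}" for t
    by (rule summable_comparison_test'[OF sc, where N = 0]) (use p_bound[OF that] in auto)
  have p_sq: "square_integrable (p k)" for k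
    unfolding p_def by (intro square_integrable_scale square_integrable_diff square_integrable_power)
  have g_sq: "square_integrable g"
  proof (rule square_integrable_bounded)
    have [measurable]: "p k \<in> borel_measurable unit_measure" for k
      using p_sq by (simp add: square_integrable_def)
    show "g \<in> borel_measurable unit_measure"
      unfolding g_def by measurable
    show "\<bar>g t\<bar> \<le> (\<Sum>k. \<bar>c k\<bar> * (1 / (real k + 1)))" if "t \<in> {0<..<1}" for t
    proof -
      have "\<bar>g t\<bar> \<le> (\<Sum>k. \<bar>c k * p k t\<bar>)"
        unfolding g_def by (rule summable_rabs[OF summ[OF that]])
      also have "\<dots> \<le> (\<Sum>k. \<bar>c k\<bar> * (1 / (real k + 1)))"
        by (intro suminf_le summ sc p_bound that)
      finally show ?thesis .
    qed
  qed
  have "inner ((hausdorff_op \<circ> integration_op) x) y = inner x (abs_L2_unit g)" for x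
  proof (cases x rule: L2_unit_cases)
    case (1 f)
    have f_int: "integrable unit_measure (\<lambda>t. \<bar>f t\<bar>)"
      using square_integrable_integrable[OF 1(1)] by simp
    have int: "integrable unit_measure (\<lambda>t. f t * (c k * p k t))" for k
      by (intro square_integrable_mult square_integrable_scale p_sq 1)
    have "inner ((hausdorff_op \<circ> integration_op) x) y = (\<Sum>k. inner x (moment_vec k) * c k)"
      unfolding inner_ell2.rep_eq hausdorff_integration_nth c_def ..
    also have "\<dots> = (\<Sum>k. LINT t|unit_measure. f t * (c k * p k t))"
      unfolding 1(2) moment_vec_abs p_def[symmetric] inner_L2_unit_abs[OF 1(1) p_sq]
      by (simp add: mult_ac)
    \<comment> \<open>Sum and integral may be exchanged: the L^1 norms of the terms are dominated by
      that of \<open>f\<close> times the summable |c_k| / (k+1).\<close>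
    also have "\<dots> = (LINT t|unit_measure. (\<Sum>k. f t * (c k * p k t)))"
    proof (rule integral_suminf[symmetric, OF int])
      show "AE t in unit_measure. summable (\<lambda>k. norm (f t * (c k * p k t)))"
        using summ by (intro AE_I2) (simp add: space_restrict_space abs_mult summable_mult)
      show "summable (\<lambda>k. LINT t|unit_measure. norm (f t * (c k * p k t)))"
      proof (rule summable_comparison_test'[where N = 0])
        show "summable (\<lambda>k. (LINT t|unit_measure. \<bar>f t\<bar>) * (\<bar>c k\<bar> * (1 / (real k + 1))))"
          by (rule summable_mult[OF sc])
        fix k
        have "(LINT t|unit_measure. norm (f t * (c k * p k t)))
          \<le> (LINT t|unit_measure. \<bar>f t\<bar> * (\<bar>c k\<bar> * (1 / (real k + 1))))"
        proof (rule integral_mono)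
          show "integrable unit_measure (\<lambda>t. norm (f t * (c k * p k t)))"
            using int by (rule integrable_norm)
          show "integrable unit_measure (\<lambda>t. \<bar>f t\<bar> * (\<bar>c k\<bar> * (1 / (real k + 1))))"
            using f_int by (rule integrable_mult_left)
          show "norm (f t * (c k * p k t)) \<le> \<bar>f t\<bar> * (\<bar>c k\<bar> * (1 / (real k + 1)))"
            if "t \<in> space unit_measure" for t
            unfolding real_norm_def abs_mult[of "f t"]
            by (intro mult_left_mono p_bound) (use that in \<open>auto simp: space_restrict_space\<close>)
        qed
        then show "norm (LINT t|unit_measure. norm (f t * (c k * p k t)))
          \<le> (LINT t|unit_measure. \<bar>f t\<bar>) * (\<bar>c k\<bar> * (1 / (real k + 1)))"
          by (simp add: integral_nonneg_AE)
      qed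
    qed
    also have "\<dots> = (LINT t|unit_measure. f t * g t)"
    proof (rule Bochner_Integration.integral_cong)
      fix t assume "t \<in> space unit_measure"
      then have "t \<in> {0<..<1}" by (simp add: space_restrict_space)
      then have "summable (\<lambda>k. c k * p k t)" by (rule summable_rabs_cancel[OF summ])
      then show "(\<Sum>k. f t * (c k * p k t)) = f t * g t" unfolding g_def by (rule suminf_mult)
    qed simp
    also have "\<dots> = inner x (abs_L2_unit g)"
      unfolding 1(2) inner_L2_unit_abs[OF 1(1) g_sq] ..
    finally show ?thesis .
  qed
  then show ?thesis by blast
qed

lemma adjoint_works_hausdorff_integration:
  "inner ((hausdorff_op \<circ> integration_op) x) y = inner x (adjoint (hausdorff_op \<circ> integration_op) y)"
  by (rule adjoint_inner[OF hausdorff_integration_adjoint_exists])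

section \<open>Decay of the singular values\<close>

lemma inverse_cube_tail:
  assumes "1 \<le> n"
  shows "(\<Sum>k<N. if k < n then 0 else 1 / ((real k + 1)\<^sup>2 * (2 * real k + 3))) \<le> 1 / (real n)\<^sup>2"
proof -
  \<comment> \<open>Keeping the term \<open>1 / N^2\<close> makes the induction telescope.\<close>
  have "(\<Sum>k<N. if k < n then 0 else 1 / ((real k + 1)\<^sup>2 * (2 * real k + 3)))
    \<le> 1 / (real n)\<^sup>2 - (if N < n then 0 else 1 / (real N)\<^sup>2)"
  proof (induction N)
    case (Suc N)
    have "1 / ((real N + 1)\<^sup>2 * (2 * real N + 3)) \<le> 1 / (real N)\<^sup>2 - 1 / (real (Suc N))\<^sup>2" if "n \<le> N"
    proof -
      define x where "x = real N"
      have x: "x \<ge> 1" using that assms by (simp add: x_def)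
      have "1 / (x\<^sup>2) - 1 / ((x + 1)\<^sup>2) - 1 / ((x + 1)\<^sup>2 * (2 * x + 3))
        = (3 * x\<^sup>2 + 8 * x + 3) / (x\<^sup>2 * ((x + 1)\<^sup>2 * (2 * x + 3)))"
        using x by (simp add: divide_simps) (simp add: algebra_simps power2_eq_square)
      also have "\<dots> \<ge> 0" using x by simp
      finally show ?thesis by (simp add: x_def add.commute)
    qed
    \<comment> \<open>At \<open>Suc N = n\<close> the bound drops to 0, which holds because all
      summands so far are 0.\<close>
    then show ?case using Suc by (cases "N < n"; cases "Suc N = n") auto
  qed (use assms in simp)
  also have "\<dots> \<le> 1 / (real n)\<^sup>2" by simp
  finally show ?thesis .
qed

text \<open>This crude bound serves the indices \<open>i < 4\<close>, where nothing is subtracted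
  from the moment vectors.\<close>

lemma norm_moment_vec_le: "(norm (moment_vec k))\<^sup>2 \<le> (1 / (real k + 1))\<^sup>2"
proof -
  have "inner (monom_L2 0 - monom_L2 (Suc k)) (monom_L2 0 - monom_L2 (Suc k))
    = 1 - 2 / (real k + 2) + 1 / (2 * real k + 3)"
    by (simp add: inner_diff inner_monom_L2 add_ac)
  then have "(norm (moment_vec k))\<^sup>2 = (1 / (real k + 1))\<^sup>2 * (1 - 2 / (real k + 2) + 1 / (2 * real k + 3))"
    unfolding power2_norm_eq_inner moment_vec_def inner_scaleR_left inner_scaleR_right
    by (simp only: power2_eq_square mult.assoc)
  also have "\<dots> \<le> (1 / (real k + 1))\<^sup>2 * 1"
  proof (rule mult_left_mono)
    have "1 / (2 * real k + 3) \<le> 2 / (real k + 2)" by (simp add: divide_simps)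
    then show "1 - 2 / (real k + 2) + 1 / (2 * real k + 3) \<le> 1" by simp
  qed simp
  finally show ?thesis by simp
qed

lemma singular_value_hausdorff_integration_le:
  assumes "1 \<le> i"
  shows "singular_value (hausdorff_op \<circ> integration_op) i \<le> 16 / real i powr (3 / 2)"
proof -
  define b where "b = 16 / real i powr (3 / 2)"
  have b0: "0 \<le> b" by (simp add: b_def)
  have "(real i powr (3 / 2))\<^sup>2 = real i ^ 3"
    using assms by (simp add: power2_eq_square powr_add[symmetric] del: powr_add)
  then have b2: "b\<^sup>2 = 256 / real i ^ 3"
    by (simp add: b_def power_divide)
  have "singular_value (hausdorff_op \<circ> integration_op) i \<le> b"
  proof (cases "i < 4")
    case True
    show ?thesis
    proof (rule singular_value_upper_bound[OF adjoint_works_hausdorff_integration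
          hausdorff_integration_nth, where B = "{}" and \<psi> = moment_vec and H = 2])
      show "(\<Sum>k<N. (norm (moment_vec k))\<^sup>2) \<le> 2" for N
        by (rule order_trans[OF sum_mono[OF norm_moment_vec_le] sum_inverse_squares_le])
      \<comment> \<open>After cancelling, the claim is 2 i^2 <= 256.\<close>
      have "i = 1 \<or> i = 2 \<or> i = 3" using True assms by auto
      then show "real i * 2 \<le> (b * (real i - real (card {})))\<^sup>2"
        unfolding power_mult_distrib b2 by auto
    qed (use assms b0 in auto)
  next
    case False
    define n where "n = i div 2"
    \<comment> \<open>Both \<open>n\<close> and \<open>i - (n + 1)\<close> are at least a quarter of
      \<open>i\<close>, the latter with equality at \<open>i = 4\<close>. These two quarters lead to
      the constant 16.\<close>
    have n: "1 \<le> n" "real i \<le> 4 * real n" "real i \<le> 4 * (real i - (real n + 1))" "n + 1 < i"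
      using False by (auto simp: n_def)
    define B where "B = monom_L2 ` {..n}"
    have cB: "card B \<le> n + 1" unfolding B_def using card_image_le[of "{..n}" monom_L2] by simp
    \<comment> \<open>For \<open>k < n\<close> the moment vector lies in the span. For
      \<open>k >= n\<close> only its constant part is removed, and the rest is small because the
      squared norm of t^(k+1) is 1/(2k+3).\<close>
    define \<psi> where "\<psi> k = (if k < n then 0 else - (1 / (real k + 1)) *\<^sub>R monom_L2 (Suc k))" for k
    show ?thesis
    proof (rule singular_value_upper_bound[OF adjoint_works_hausdorff_integration
          hausdorff_integration_nth, where B = B and \<psi> = \<psi> and H = "1 / (real n)\<^sup>2"])
      show "moment_vec k - \<psi> k \<in> span B" for k
      proof -
        have mem: "monom_L2 j \<in> span B" if "j \<le> n" for j
          using that by (auto simp: B_def intro: span_base)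
        show ?thesis
        proof (cases "k < n")
          case True
          then show ?thesis using mem[of 0] mem[of "Suc k"]
            by (simp add: \<psi>_def moment_vec_def span_scale span_diff)
        next
          case False
          then have "moment_vec k - \<psi> k = (1 / (real k + 1)) *\<^sub>R monom_L2 0"
            by (simp add: \<psi>_def moment_vec_def scaleR_diff_right)
          then show ?thesis using mem[of 0] by (simp add: span_scale)
        qed
      qed
      have "(norm (\<psi> k))\<^sup>2 = (if k < n then 0 else 1 / ((real k + 1)\<^sup>2 * (2 * real k + 3)))" for k
        unfolding power2_norm_eq_inner \<psi>_def
        by (simp add: inner_monom_L2 power2_eq_square add_ac)
      then show "(\<Sum>k<N. (norm (\<psi> k))\<^sup>2) \<le> 1 / (real n)\<^sup>2" for N
        using inverse_cube_tail[OF n(1), of N] by simp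
      have 1: "real i / 4 \<le> real i - real (card B)" using n(3) of_nat_mono[OF cB, where ?'a = real] by simp
      have "real i * (1 / (real n)\<^sup>2) \<le> real i * (1 / (real i / 4)\<^sup>2)"
        using n(1,2,4) by (intro mult_left_mono divide_left_mono power_mono) auto
      \<comment> \<open>Both sides equal 16 / i.\<close>
      also have "\<dots> = b\<^sup>2 * (real i / 4)\<^sup>2"
        using assms unfolding b2 by (simp add: field_simps power2_eq_square power3_eq_cube)
      also have "\<dots> \<le> b\<^sup>2 * (real i - real (card B))\<^sup>2"
        using 1 by (intro mult_left_mono power_mono) auto
      finally show "real i * (1 / (real n)\<^sup>2) \<le> (b * (real i - real (card B)))\<^sup>2"
        by (simp add: power_mult_distrib)
    qed (use cB n(4) b0 in \<open>auto simp: B_def\<close>)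
  qed
  then show ?thesis by (simp add: b_def)
qed

theorem theorem3:
  shows "(\<exists>C::real. C > 0 \<and>
      (\<forall>i::nat. i \<ge> 1 \<longrightarrow>
        singular_value (hausdorff_op \<circ> integration_op) i \<le> C / real i powr (3 / 2))) \<and>
    (\<exists>K::real. K > 0 \<and>
      (\<forall>i::nat. i \<ge> 1 \<longrightarrow>
        singular_value (hausdorff_op \<circ> integration_op) i / singular_value integration_op i
          \<le> K / real i powr (1 / 2)))"
proof
  show "\<exists>C::real. C > 0 \<and> (\<forall>i::nat. i \<ge> 1 \<longrightarrow>
      singular_value (hausdorff_op \<circ> integration_op) i \<le> C / real i powr (3 / 2))"
    using singular_value_hausdorff_integration_le by (intro exI[of _ 16]) auto
  have "singular_value (hausdorff_op \<circ> integration_op) i / singular_value integration_op i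
      \<le> 16 * pi / real i powr (1 / 2)" if i: "1 \<le> i" for i
  proof -
    \<comment> \<open>The positive lower bound for the denominator justifies the division; it
      cancels one power of \<open>i\<close> and contributes the factor \<open>pi\<close>.\<close>
    have "singular_value (hausdorff_op \<circ> integration_op) i / singular_value integration_op i
      \<le> (16 / real i powr (3 / 2)) / (1 / (pi * real i))"
      using singular_value_integration_op_ge[OF i] singular_value_hausdorff_integration_le[OF i] i
      by (intro frac_le) auto
    also have "real i powr (3 / 2) = real i powr (1 / 2) * real i"
      using i powr_add[of "real i" "1 / 2" 1] by simp
    also have "16 / (real i powr (1 / 2) * real i) / (1 / (pi * real i)) = 16 * pi / real i powr (1 / 2)"
      using i by (simp add: field_simps)
    finally show ?thesis .
  qed
  then show "\<exists>K::real. K > 0 \<and> (\<forall>i::nat. i \<ge> 1 \<longrightarrow>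
      singular_value (hausdorff_op \<circ> integration_op) i / singular_value integration_op i
        \<le> K / real i powr (1 / 2))"
    by (intro exI[of _ "16 * pi"]) auto
qed

end
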